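(* Let $$Q_{1} = (x^4 + y^4 )(x^4 + y^4 + z^4 ),\quad Q_{2} = (y^4 + z^4 )(x^4 + y^4 + z^4 ),\quad Q_{3} = (x^4 + z^4 )(x^4 + y^4 + z^4 ),$$ and let $$R_1=(x^4+z^4)(y^4+z^4),\quad R_2=(x^4+y^4)(x^4+z^4),\quad R_3=(x^4+y^4)(y^4+z^4).$$ For $k\in\{1,2,3\}$ let $\ell_i,\ell_j$ be two distinct linear forms among the $8$ linear factors of $R_k$ over $\mathbb{C}$, and put $$G_k^{i,j}(x,y,z)=Q_k(x,y,z)\cdot \ell_i(x,y,z)\cdot \ell_j(x,y,z).$$ Then every arrangement $\mathcal{C}_k^{i,j}\subset\mathbb{P}^2_{\mathbb{C}}$ defined by $G_k^{i,j}=0$ is nearly-free.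
   Context: Let $S=\mathbb{C}[x,y,z]$. For a reduced curve $C: f=0$ of degree $d$ in $\mathbb{P}^2_{\mathbb{C}}$, let $J_f$ be the ideal generated by the partial derivatives of $f$ and $M(f)=S/J_f$ the Milnor algebra. $C$ is an $m$-syzygy curve if $M(f)$ has minimal graded free resolution $$0 \rightarrow \bigoplus_{i=1}^{m-2}S(-e_{i}) \rightarrow \bigoplus_{i=1}^{m}S(1-d - d_{i}) \rightarrow S^{3}(1-d)\rightarrow S \rightarrow M(f) \rightarrow 0$$ with $e_{1} \leq \dots \leq e_{m-2}$ and $1\leq d_{1} \leq \dots \leq d_{m}$. $C$ is nearly-free if $m=3$, $d_1+d_2=d$, $d_2=d_3$ and $e_1=d+d_2$. *)

theory Defs
  imports
    "Jordan_Normal_Form.Matrix_Kernel"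
    "HOL-Algebra.QuotRing"
    "HOL-Computational_Algebra.Squarefree"
    "HOL-Computational_Algebra.Field_as_Ring"
begin

subsection \<open>The polynomial ring in three variables\<close>

text \<open>
  \<open>\<complex>[x,y,z]\<close> is rendered as \<open>\<complex>[x][y][z]\<close>: the innermost variable is \<open>x\<close>, the outermost \<open>z\<close>.
\<close>

type_synonym poly3 = "complex poly poly poly"

definition X :: poly3 where "X = [:[:[:0, 1:]:]:]"
definition Y :: poly3 where "Y = [:[:0, 1:]:]"
definition Z :: poly3 where "Z = [:0, 1:]"

definition coeff3 :: "poly3 \<Rightarrow> nat \<Rightarrow> nat \<Rightarrow> nat \<Rightarrow> complex" where
  "coeff3 p i j k = coeff (coeff (coeff p k) j) i"

definition dX :: "poly3 \<Rightarrow> poly3" where "dX = map_poly (map_poly pderiv)"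
definition dY :: "poly3 \<Rightarrow> poly3" where "dY = map_poly pderiv"
definition dZ :: "poly3 \<Rightarrow> poly3" where "dZ = pderiv"

lemma coeff3_dX: "coeff3 (dX p) i j k = of_nat (Suc i) * coeff3 p (Suc i) j k"
  by (simp add: dX_def coeff3_def coeff_map_poly coeff_pderiv)

lemma coeff3_dY: "coeff3 (dY p) i j k = of_nat (Suc j) * coeff3 p i (Suc j) k"
  by (simp add: dY_def coeff3_def coeff_map_poly coeff_pderiv of_nat_poly)

lemma coeff3_dZ: "coeff3 (dZ p) i j k = of_nat (Suc k) * coeff3 p i j (Suc k)"
  by (simp add: dZ_def coeff3_def coeff_pderiv of_nat_poly)

text \<open>
  The degree is an integer so that it can be shifted freely; in negative degree only \<open>0\<close> is
  homogeneous.
\<close>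

definition homogeneous :: "int \<Rightarrow> poly3 \<Rightarrow> bool" where
  "homogeneous n p \<longleftrightarrow> (\<forall>i j k. coeff3 p i j k \<noteq> 0 \<longrightarrow> int (i + j + k) = n)"

definition linear_form :: "poly3 \<Rightarrow> bool" where
  "linear_form l \<longleftrightarrow> l \<noteq> 0 \<and> homogeneous 1 l"

subsection \<open>The Milnor algebra\<close>

definition jacobian_ideal :: "poly3 \<Rightarrow> poly3 set" where
  "jacobian_ideal f = Idl\<^bsub>class_ring\<^esub> {dX f, dY f, dZ f}"

definition milnor_algebra :: "poly3 \<Rightarrow> poly3 set ring" where
  "milnor_algebra f = class_ring Quot jacobian_ideal f"

definition milnor_proj :: "poly3 \<Rightarrow> poly3 \<Rightarrow> poly3 set" where
  "milnor_proj f p = jacobian_ideal f +>\<^bsub>class_ring\<^esub> p"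

definition irrelevant_ideal :: "poly3 set" where
  "irrelevant_ideal = Idl\<^bsub>class_ring\<^esub> {X, Y, Z}"

subsection \<open>Graded free modules and resolutions\<close>

text \<open>
  A list of integers \<open>[a\<^sub>1, \<dots>, a\<^sub>n]\<close> stands for the graded free module
  \<open>S(a\<^sub>1) \<oplus> \<dots> \<oplus> S(a\<^sub>n)\<close>, where \<open>S(a)\<^sub>k = S\<^bsub>a+k\<^esub>\<close>.
  Its elements are the vectors of length \<open>n\<close>; \<open>graded_part\<close> is the part of degree \<open>k\<close>.
\<close>

definition graded_part :: "int list \<Rightarrow> int \<Rightarrow> poly3 vec set" where
  "graded_part as k =
     {v \<in> carrier_vec (length as). \<forall>i < length as. homogeneous (as ! i + k) (v $ i)}"

text \<open>
  \<open>S\<close>-linear maps are matrices acting on column vectors; \<open>graded_hom as bs\<close> are those of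
  degree \<open>0\<close> from the module with shifts \<open>as\<close> to the one with shifts \<open>bs\<close>.
\<close>

definition graded_hom :: "int list \<Rightarrow> int list \<Rightarrow> poly3 mat set" where
  "graded_hom as bs =
     {A \<in> carrier_mat (length bs) (length as).
        \<forall>k. \<forall>v \<in> graded_part as k. A *\<^sub>v v \<in> graded_part bs k}"

definition mat_image :: "poly3 mat \<Rightarrow> poly3 vec set" where
  "mat_image A = {A *\<^sub>v v | v. v \<in> carrier_vec (dim_col A)}"

text \<open>
  Minimality of a resolution: the image of each differential lies in the irrelevant ideal times
  its target.
\<close>

definition minimal_map :: "poly3 mat \<Rightarrow> bool" where
  "minimal_map A \<longleftrightarrow> (\<forall>v \<in> mat_image A. \<forall>i < dim_row A. v $ i \<in> irrelevant_ideal)"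

text \<open>
  \<open>0 \<rightarrow> F\<^sub>3 \<rightarrow> F\<^sub>2 \<rightarrow> F\<^sub>1 \<rightarrow> S \<rightarrow> M(f) \<rightarrow> 0\<close> with differentials \<open>A\<^sub>3, A\<^sub>2, A\<^sub>1\<close>; the augmentation
  \<open>S \<rightarrow> M(f)\<close> is the canonical projection, which is surjective.
\<close>

definition minimal_milnor_resolution ::
  "poly3 \<Rightarrow> int list \<Rightarrow> int list \<Rightarrow> int list \<Rightarrow> poly3 mat \<Rightarrow> poly3 mat \<Rightarrow> poly3 mat \<Rightarrow> bool" where
  "minimal_milnor_resolution f F1 F2 F3 A1 A2 A3 \<longleftrightarrow>
     A1 \<in> graded_hom F1 [0] \<and> A2 \<in> graded_hom F2 F1 \<and> A3 \<in> graded_hom F3 F2 \<and>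
     minimal_map A1 \<and> minimal_map A2 \<and> minimal_map A3 \<and>
     mat_image A1 = {v \<in> carrier_vec 1. milnor_proj f (v $ 0) = \<zero>\<^bsub>milnor_algebra f\<^esub>} \<and>
     mat_image A2 = mat_kernel A1 \<and>
     mat_image A3 = mat_kernel A2 \<and>
     mat_kernel A3 = {0\<^sub>v (length F3)}"

subsection \<open>Syzygy curves and nearly-free curves\<close>

text \<open>The curve \<open>f = 0\<close> is reduced iff \<open>f\<close> is squarefree.\<close>

definition reduced_curve :: "poly3 \<Rightarrow> nat \<Rightarrow> bool" where
  "reduced_curve f d \<longleftrightarrow> d \<ge> 1 \<and> f \<noteq> 0 \<and> homogeneous (int d) f \<and> squarefree f"

text \<open>
  \<open>syzygy_curve f d m ds es\<close>: the curve \<open>f = 0\<close> of degree \<open>d\<close> is an \<open>m\<close>-syzygy curve with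
  exponents \<open>ds = [d\<^sub>1, \<dots>, d\<^sub>m]\<close> and \<open>es = [e\<^sub>1, \<dots>, e\<^bsub>m-2\<^esub>]\<close>.
\<close>

definition syzygy_curve :: "poly3 \<Rightarrow> nat \<Rightarrow> nat \<Rightarrow> nat list \<Rightarrow> nat list \<Rightarrow> bool" where
  "syzygy_curve f d m ds es \<longleftrightarrow>
     reduced_curve f d \<and> m \<ge> 2 \<and>
     length ds = m \<and> sorted ds \<and> (\<forall>a \<in> set ds. 1 \<le> a) \<and>
     length es = m - 2 \<and> sorted es \<and>
     (\<exists>A1 A2 A3. minimal_milnor_resolution f
        (replicate 3 (1 - int d)) (map (\<lambda>a. 1 - int d - int a) ds) (map (\<lambda>e. - int e) es)
        A1 A2 A3)"

definition nearly_free :: "poly3 \<Rightarrow> bool" where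
  "nearly_free f \<longleftrightarrow>
     (\<exists>d d1 d2 d3 e1. syzygy_curve f d 3 [d1, d2, d3] [e1] \<and>
        d1 + d2 = d \<and> d2 = d3 \<and> e1 = d + d2)"

subsection \<open>The polynomials of the arrangements\<close>

definition Q :: "nat \<Rightarrow> poly3" where
  "Q k = (if k = 1 then (X ^ 4 + Y ^ 4) * (X ^ 4 + Y ^ 4 + Z ^ 4)
          else if k = 2 then (Y ^ 4 + Z ^ 4) * (X ^ 4 + Y ^ 4 + Z ^ 4)
          else (X ^ 4 + Z ^ 4) * (X ^ 4 + Y ^ 4 + Z ^ 4))"

definition R :: "nat \<Rightarrow> poly3" where
  "R k = (if k = 1 then (X ^ 4 + Z ^ 4) * (Y ^ 4 + Z ^ 4)
          else if k = 2 then (X ^ 4 + Y ^ 4) * (X ^ 4 + Z ^ 4)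
          else (X ^ 4 + Y ^ 4) * (Y ^ 4 + Z ^ 4))"

end

theory Submission
  imports Defs
begin

text \<open>
  A linear factor of \<open>R k\<close> is a constant multiple of \<open>U - a W\<close> or \<open>V - a W\<close> with \<open>a\<^sup>4 = -1\<close>, where
  \<open>(U, V, W)\<close> is a permutation of the coordinates with \<open>Q k = (U\<^sup>4 + V\<^sup>4) (U\<^sup>4 + V\<^sup>4 + W\<^sup>4)\<close>. Rescaling \<open>V\<close> and \<open>W\<close>
  turns the two chosen lines into \<open>U\<^sup>2 - W\<^sup>2\<close>, \<open>U\<^sup>2 - 2 U W + 2 W\<^sup>2\<close> or \<open>(U - W) (V - W)\<close> and the curve into
  one with rational coefficients. In each case there are three explicit syzygies \<open>\<rho>\<^sub>1, \<rho>\<^sub>2, \<rho>\<^sub>3\<close> of degree 5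
  among the partial derivatives of \<open>f\<close>, subject to the single relation \<open>U \<rho>\<^sub>1 + V \<rho>\<^sub>2 + W \<rho>\<^sub>3 = 0\<close>, and a
  nonzero minor \<open>\<rho>\<^sub>1 \<times> \<rho>\<^sub>2 = c W \<nabla>f\<close>. As \<open>\<nabla>f\<close> is primitive (\<open>f\<close> is squarefree) and the Koszul complex of
  \<open>(U, V, W)\<close> is exact, this gives the resolution with exponents \<open>(5, 5, 5)\<close> and \<open>e\<^sub>1 = 15\<close>.
\<close>

subsection \<open>Homogeneous polynomials\<close>

definition Const :: "complex \<Rightarrow> poly3" where "Const c = [:[:[:c:]:]:]"

lemma Const_simps:
  "Const (a + b) = Const a + Const b" "Const (a * b) = Const a * Const b"
  "Const (a - b) = Const a - Const b" "Const (- a) = - Const a"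
  "Const 0 = 0" "Const 1 = 1" "Const (numeral n) = numeral n"
  by (simp_all add: Const_def numeral_poly one_pCons)

lemma Const_power: "Const (a ^ n) = Const a ^ n"
  by (induction n) (simp_all add: Const_simps)

lemma coeff3_add: "coeff3 (p + q) i j k = coeff3 p i j k + coeff3 q i j k"
  by (simp add: coeff3_def)

lemma coeff3_mult:
  "coeff3 (p * q) i j k =
    (\<Sum>c\<le>k. \<Sum>b\<le>j. \<Sum>a\<le>i. coeff3 p a b c * coeff3 q (i - a) (j - b) (k - c))"
  by (simp add: coeff3_def coeff_mult coeff_sum)

lemma poly3_eqI: "(\<And>i j k. coeff3 p i j k = coeff3 q i j k) \<Longrightarrow> p = q"
  by (simp add: coeff3_def poly_eq_iff)

lemma homogeneous_0 [simp]: "homogeneous n 0"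
  by (simp add: homogeneous_def coeff3_def)

lemma homogeneous_add: "homogeneous n p \<Longrightarrow> homogeneous n q \<Longrightarrow> homogeneous n (p + q)"
  unfolding homogeneous_def coeff3_add by (metis add.right_neutral)

lemma homogeneous_uminus: "homogeneous n p \<Longrightarrow> homogeneous n (- p)"
  by (simp add: homogeneous_def coeff3_def)

lemma homogeneous_diff: "homogeneous n p \<Longrightarrow> homogeneous n q \<Longrightarrow> homogeneous n (p - q)"
  using homogeneous_add[of n p "- q"] homogeneous_uminus[of n q] by simp

lemma homogeneous_mult:
  assumes "homogeneous m p" "homogeneous n q"
  shows "homogeneous (m + n) (p * q)"
  unfolding homogeneous_def
proof (intro allI impI)
  fix i j k assume "coeff3 (p * q) i j k \<noteq> 0"
  then obtain a b c where *: "c \<le> k" "b \<le> j" "a \<le> i"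
    and "coeff3 p a b c * coeff3 q (i - a) (j - b) (k - c) \<noteq> 0"
    unfolding coeff3_mult by (metis (no_types, lifting) atMost_iff
        sum.not_neutral_contains_not_neutral)
  then have "int (a + b + c) = m" "int ((i - a) + (j - b) + (k - c)) = n"
    using assms unfolding homogeneous_def by (metis mult_zero_left, metis mult_zero_right)
  then show "int (i + j + k) = m + n" using * by linarith
qed

lemma homogeneous_Const: "homogeneous 0 (Const c)"
  by (auto simp: homogeneous_def coeff3_def Const_def coeff_pCons split: nat.splits)

lemma homogeneous_numeral: "homogeneous 0 (numeral n)"
  using homogeneous_Const[of "numeral n"] by (simp add: Const_simps)

lemma homogeneous_Const_mult: "homogeneous n p \<Longrightarrow> homogeneous n (Const c * p)"
  using homogeneous_mult[OF homogeneous_Const] by force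

lemma homogeneous_power: "homogeneous m p \<Longrightarrow> homogeneous (int n * m) (p ^ n)"
proof (induction n)
  case 0
  then show ?case using homogeneous_Const[of 1] by (simp add: Const_simps)
next
  case (Suc n)
  then show ?case using homogeneous_mult[of m p "int n * m" "p ^ n"] by (simp add: algebra_simps)
qed

lemma homogeneous_multI: "homogeneous m p \<Longrightarrow> homogeneous n q \<Longrightarrow> m + n = d \<Longrightarrow> homogeneous d (p * q)"
  using homogeneous_mult by blast

lemma homogeneous_powerI: "homogeneous m p \<Longrightarrow> int n * m = d \<Longrightarrow> homogeneous d (p ^ n)"
  using homogeneous_power by blast

lemma homogeneous_X: "homogeneous 1 X" and homogeneous_Y: "homogeneous 1 Y"
  and homogeneous_Z: "homogeneous 1 Z"
  by (auto simp: homogeneous_def coeff3_def X_def Y_def Z_def coeff_pCons one_pCons split: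
      nat.splits)

lemma homogeneous_dX: "homogeneous n p \<Longrightarrow> homogeneous (n - 1) (dX p)"
  unfolding homogeneous_def coeff3_dX by (smt (verit) add_Suc int_Suc mult_zero_right)

lemma homogeneous_dY: "homogeneous n p \<Longrightarrow> homogeneous (n - 1) (dY p)"
  unfolding homogeneous_def coeff3_dY by (smt (verit) add_Suc add_Suc_right int_Suc
      mult_zero_right)

lemma homogeneous_dZ: "homogeneous n p \<Longrightarrow> homogeneous (n - 1) (dZ p)"
  unfolding homogeneous_def coeff3_dZ by (smt (verit) add_Suc_right int_Suc mult_zero_right)

subsection \<open>Derivations\<close>

text \<open>Kept abstract so that the partial derivatives and their constant multiples, which arise
  from rescaled coordinates, share one set of rules.\<close>

locale derivation =
  fixes D :: "'a::comm_ring_1 \<Rightarrow> 'a"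
  assumes add: "D (p + q) = D p + D q"
    and mult: "D (p * q) = D p * q + p * D q"
begin

lemma zero: "D 0 = 0" using add[of 0 0] by simp
lemma one: "D 1 = 0" using mult[of 1 1] by simp
lemma uminus: "D (- p) = - D p" using add[of p "- p"] zero
    by (simp add: eq_neg_iff_add_eq_0 add.commute)
lemma diff: "D (p - q) = D p - D q" using add[of p "- q"] uminus by simp

lemma of_nat: "D (of_nat n) = 0"
  by (induction n) (simp_all add: zero one add)

lemma numeral: "D (numeral n) = 0"
  using of_nat[of "numeral n"] by simp

lemma power: "D (p ^ Suc n) = of_nat (Suc n) * p ^ n * D p"
  by (induction n) (simp_all add: one mult algebra_simps)

lemmas simps = zero one uminus diff add mult numeral

lemma power_numeral: "D (p ^ 2) = 2 * p * D p" "D (p ^ 3) = 3 * p ^ 2 * D p"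
   "D (p ^ 4) = 4 * p ^ 3 * D p"
  using power[of p 1] power[of p 2] power[of p 3] by (simp_all add: numeral_eq_Suc)

text \<open>In the nested representation a derivative in an inner variable acts on coefficients:
  \<open>pderiv\<close> is lifted once for \<open>dY\<close> and twice for \<open>dX\<close>. The
  Leibniz rule follows by peeling off one coefficient of \<open>p\<close> at a time.\<close>

lemma map_poly: "derivation (map_poly D)"
proof
  note [simp] = zero one add mult
  show *: "map_poly D (p + q) = map_poly D p + map_poly D q" for p q
    by (rule poly_eqI) (simp add: coeff_map_poly)
  show "map_poly D (p * q) = map_poly D p * q + p * map_poly D q" for p q
  proof (induction p)
    case 0 show ?case by simp
  next
    case (pCons a p)
    have "map_poly D (Polynomial.smult a q) = Polynomial.smult (D a) q +
        Polynomial.smult a (map_poly D q)"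
      by (rule poly_eqI) (simp add: coeff_map_poly)
    then show ?case using pCons(2) by (simp add: * map_poly_pCons algebra_simps)
  qed
qed

end

lemma derivation_pderiv: "derivation pderiv"
  by standard (simp_all add: pderiv_add pderiv_mult)

lemma derivation_dX: "derivation dX" and derivation_dY: "derivation dY"
  and derivation_dZ: "derivation dZ"
  unfolding dX_def dY_def dZ_def by (intro derivation.map_poly derivation_pderiv)+

subsection \<open>Ideals\<close>

text \<open>The combinations form an ideal containing the generators, and the generated ideal is the
  least such; conversely it absorbs multiples and is closed under sums.\<close>

lemma Idl_triple:
  "Idl\<^bsub>class_ring\<^esub> {a, b, c :: 'a::comm_ring_1} = {a * r + b * s + c * t | r s t. True}"
    (is "_ = ?S")
proof -
  have in_S: "x \<in> ?S" if "x = a * r + b * s + c * t" for x r s t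
    using that by blast
  have "ideal ?S (class_ring :: 'a ring)"
  proof (rule idealI)
    show "ring (class_ring :: 'a ring)" by (rule class_ring.ring_axioms)
    show "subgroup ?S (add_monoid (class_ring :: 'a ring))"
    proof (rule subgroup.intro)
      fix x assume "x \<in> ?S"
      then obtain r s t where "x = a * r + b * s + c * t" by blast
      then have "\<ominus>\<^bsub>class_ring\<^esub> x \<in> ?S"
        unfolding class_ring_simps
        by (intro in_S[of _ "- r" "- s" "- t"]) (simp add: algebra_simps)
      then show "inv\<^bsub>add_monoid class_ring\<^esub> x \<in> ?S"
        by (simp only: a_inv_def)
    next
      fix x y assume "x \<in> ?S" "y \<in> ?S"
      then obtain r s t r' s' t' where "x = a * r + b * s + c * t" "y = a * r' + b * s' + c * t'"
        by blast
      then have "x + y \<in> ?S"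
        by (intro in_S[of _ "r + r'" "s + s'" "t + t'"]) (simp add: algebra_simps)
      then show "x \<otimes>\<^bsub>add_monoid class_ring\<^esub> y \<in> ?S" by simp
    qed (use in_S[of 0 0 0 0] in auto)
  next
    fix x y assume "x \<in> ?S"
    then obtain r s t where "x = a * r + b * s + c * t" by blast
    then have "y * x \<in> ?S"
      by (intro in_S[of _ "y * r" "y * s" "y * t"]) (simp add: algebra_simps)
    then show "y \<otimes>\<^bsub>class_ring\<^esub> x \<in> ?S" "x \<otimes>\<^bsub>class_ring\<^esub> y \<in> ?S"
      by (simp_all only: class_ring_simps mult.commute)
  qed
  then have 1: "Idl\<^bsub>class_ring\<^esub> {a, b, c} \<subseteq> ?S"
    using in_S[of a 1 0 0] in_S[of b 0 1 0] in_S[of c 0 0 1]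
    by (intro ring.genideal_minimal[OF class_ring.ring_axioms]) auto
  interpret I: ideal "Idl\<^bsub>class_ring\<^esub> {a, b, c}" "class_ring :: 'a ring"
    by (rule ring.genideal_ideal[OF class_ring.ring_axioms]) simp
  have "x * r \<in> Idl\<^bsub>class_ring\<^esub> {a, b, c}" if "x \<in> {a, b, c}" for x r
    using I.I_r_closed[of x r] that ring.genideal_self[OF class_ring.ring_axioms, of "{a, b, c}"]
    by (auto simp: class_ring_simps)
  then have 2: "a * r + b * s + c * t \<in> Idl\<^bsub>class_ring\<^esub> {a, b, c}" for r s t
    using I.a_closed unfolding class_ring_simps by auto
  show ?thesis using 1 2 by blast
qed

text \<open>Reduces exactness at \<open>S\<close> to membership in the Jacobian ideal, through which
  alone the resolution then depends on \<open>f\<close>.\<close>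

lemma milnor_proj_eq_zero:
  "milnor_proj f p = \<zero>\<^bsub>milnor_algebra f\<^esub> \<longleftrightarrow> p \<in> jacobian_ideal f"
proof -
  interpret I: ideal "jacobian_ideal f" "class_ring :: poly3 ring"
    unfolding jacobian_ideal_def by (rule ring.genideal_ideal[OF class_ring.ring_axioms]) simp
  show ?thesis
    unfolding milnor_proj_def milnor_algebra_def FactRing_def
    using I.rcos_const_imp_mem[of p] I.a_rcos_const[of p] by auto
qed

subsection \<open>Linear forms\<close>

lemma is_unit_poly3:
  assumes "is_unit (p :: poly3)"
  obtains c where "c \<noteq> 0" "p = Const c"
  using assms unfolding Const_def is_unit_poly_iff by (metis dvdE mult_zero_left zero_neq_one)

lemma is_unit_Const: "c \<noteq> 0 \<Longrightarrow> is_unit (Const c)"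
  by (simp add: Const_def is_unit_poly_iff dvd_field_iff)

lemma linear_form_pCons:
  assumes "linear_form l"
  obtains a b c where "l = [:[:[:0, a:], [:b:]:], [:[:c:]:]:]" "a \<noteq> 0 \<or> b \<noteq> 0 \<or> c \<noteq> 0"
proof -
  have hom: "coeff3 l i j k = 0" if "i + j + k \<noteq> 1" for i j k
    using assms that unfolding linear_form_def homogeneous_def by fastforce
  have l: "l = [:[:[:0, coeff3 l 1 0 0:], [:coeff3 l 0 1 0:]:], [:[:coeff3 l 0 0 1:]:]:]"
  proof (rule poly3_eqI)
    fix i j k
    show "coeff3 l i j k = coeff3 [:[:[:0, coeff3 l 1 0 0:], [:coeff3 l 0 1 0:]:],
        [:[:coeff3 l 0 0 1:]:]:] i j k"
      using hom[of i j k] unfolding coeff3_def[of "[:_, _:]"]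
      by (auto simp: coeff_pCons split: nat.splits)
  qed
  moreover have "l \<noteq> 0" using assms by (simp add: linear_form_def)
  ultimately show thesis using that by fastforce
qed

text \<open>In the outermost variable that occurs, the form is of degree one with a unit as leading
  coefficient, hence prime; variables that do not occur only wrap it as a constant polynomial, which
  preserves primality.\<close>

lemma prime_elem_linear_form:
  assumes "linear_form l"
  shows "prime_elem l"
proof -
  obtain a b c where l: "l = [:[:[:0, a:], [:b:]:], [:[:c:]:]:]" and "a \<noteq> 0 \<or> b \<noteq> 0 \<or> c \<noteq> 0"
    using linear_form_pCons[OF assms] .
  then consider "c \<noteq> 0" | "c = 0" "b \<noteq> 0" | "c = 0" "b = 0" "a \<noteq> 0" by blast
  then show ?thesis
  proof cases
    case 1
    then have "is_unit [:[:c:]:]" by (simp add: is_unit_poly_iff dvd_field_iff)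
    then show ?thesis unfolding l using 1 by (intro prime_elem_linear_poly
        is_unit_right_imp_coprime) simp_all
  next
    case 2
    then have "is_unit [:b:]" by (simp add: is_unit_poly_iff dvd_field_iff)
    then show ?thesis unfolding l using 2
      by (simp add: prime_elem_const_poly_iff prime_elem_linear_poly is_unit_right_imp_coprime)
  next
    case 3
    then show ?thesis unfolding l
      by (simp add: prime_elem_const_poly_iff prime_elem_linear_field_poly)
  qed
qed

lemma linear_form_dvd_linear_form:
  assumes "linear_form l" "linear_form m" "l dvd m"
  obtains c where "c \<noteq> 0" "l = Const c * m"
proof -
  obtain k where k: "m = l * k" using assms(3) by blast
  have "is_unit k"
    using prime_elem_imp_irreducible[OF prime_elem_linear_form[OF assms(2)]] k
      prime_elem_linear_form[OF assms(1)] irreducibleD prime_elem_not_unit by blast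
  then obtain c where c: "c \<noteq> 0" "k = Const c" by (rule is_unit_poly3)
  then have "l = Const (1 / c) * m" 
    using k Const_simps(2)[of "1 / c" c] Const_simps(6)
        by (simp add: mult.assoc mult.left_commute)
  then show thesis using that[of "1 / c"] c by simp
qed

subsection \<open>Syzygies of the gradient\<close>

text \<open>A vector parallel to a primitive one is a multiple of it: \<open>f3\<close> divides
  \<open>u3\<close> times each of \<open>f1\<close>, \<open>f2\<close>, \<open>f3\<close>, hence
  \<open>u3\<close> times their gcd, which is a unit. Cancelling \<open>f3\<close> gives the other
  two coordinates.\<close>

lemma primitive_cross_product:
  fixes f1 f2 f3 :: "'a::{ring_gcd}"
  assumes coprime: "\<And>d. d dvd f1 \<Longrightarrow> d dvd f2 \<Longrightarrow> d dvd f3 \<Longrightarrow> is_unit d" and "f3 \<noteq> 0"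
    and cross: "u2 * f3 = u3 * f2" "u3 * f1 = u1 * f3"
  obtains a where "u1 = a * f1" "u2 = a * f2" "u3 = a * f3"
proof -
  have dvd_gcd: "f3 dvd u3 * gcd a b" if "f3 dvd u3 * a" "f3 dvd u3 * b" for a b
    using gcd_greatest[OF that] unfolding gcd_mult_left
    unfolding dvd_normalize_iff .
  have "f3 dvd u3 * gcd f1 (gcd f2 f3)"
    using cross by (intro dvd_gcd) (metis dvd_triv_right)+
  moreover have "is_unit (gcd f1 (gcd f2 f3))"
    by (rule coprime) (simp_all add: dvd_trans[OF gcd_dvd2])
  ultimately have "f3 dvd u3" by (simp add: dvd_mult_unit_iff)
  then obtain a where a: "u3 = a * f3" by (metis dvdE mult.commute)
  then have "u1 * f3 = a * f1 * f3" "u2 * f3 = a * f2 * f3"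
    using cross by (simp_all add: ac_simps)
  then show thesis using a \<open>f3 \<noteq> 0\<close> by (intro that[of a]) simp_all
qed

text \<open>
  The columns \<open>\<rho>\<^sub>1, \<rho>\<^sub>2, \<rho>\<^sub>3\<close> of \<open>r\<close> are syzygies of \<open>\<nabla>f\<close> with \<open>x\<rho>\<^sub>1 + y\<rho>\<^sub>2 + z\<rho>\<^sub>3 = 0\<close>. For any syzygy \<open>u\<close>
  the cross products \<open>\<rho>\<^sub>j \<times> u\<close> are multiples \<open>\<alpha>\<^sub>j\<nabla>f\<close>, and \<open>x\<alpha>\<^sub>1 + y\<alpha>\<^sub>2 + z\<alpha>\<^sub>3 = 0\<close>; by exactness of the Koszul
  complex some combination of the \<open>\<rho>\<^sub>j\<close> has the same cross products as \<open>u\<close>.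
\<close>

lemma syzygy_span:
  fixes x y z :: "'a::idom"
  assumes prim: "\<And>u1 u2 u3. u2 * f3 = u3 * f2 \<Longrightarrow> u3 * f1 = u1 * f3 \<Longrightarrow>
      \<exists>a. u1 = a * f1 \<and> u2 = a * f2 \<and> u3 = a * f3"
    and koszul: "\<And>a b c. x * a + y * b + z * c = 0 \<Longrightarrow>
      \<exists>\<alpha> \<beta> \<gamma>. a = y * \<gamma> - z * \<beta> \<and> b = z * \<alpha> - x * \<gamma> \<and> c = x * \<beta> - y * \<alpha>"
    and rel: "x * r11 + y * r12 + z * r13 = 0" "x * r21 + y * r22 + z * r23 = 0"
      "x * r31 + y * r32 + z * r33 = 0"
    and syz: "f1 * r11 + f2 * r21 + f3 * r31 = 0" "f1 * r12 + f2 * r22 + f3 * r32 = 0"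
      "f1 * r13 + f2 * r23 + f3 * r33 = 0"
    and minor: "r11 * r22 - r12 * r21 = c * (z * f3)" and c: "c * c' = 1"
    and nz: "z \<noteq> 0" "f3 \<noteq> 0"
    and u: "f1 * u1 + f2 * u2 + f3 * u3 = 0"
  shows "\<exists>b1 b2 b3. u1 = r11 * b1 + r12 * b2 + r13 * b3 \<and> u2 = r21 * b1 + r22 * b2 + r23 * b3 \<and>
    u3 = r31 * b1 + r32 * b2 + r33 * b3"
proof -
  \<comment> \<open>Two vectors orthogonal to the gradient have a cross product parallel to it, and
    \<open>prim\<close> makes that a multiple.\<close>
  have cross: "\<exists>a. s2 * t3 - s3 * t2 = a * f1 \<and> s3 * t1 - s1 * t3 = a * f2 \<and> s1 * t2 - s2 * t1 =
      a * f3"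
    if "f1 * s1 + f2 * s2 + f3 * s3 = 0" "f1 * t1 + f2 * t2 + f3 * t3 = 0" for s1 s2 s3 t1 t2 t3
  proof (rule prim)
    have "(s3 * t1 - s1 * t3) * f3 - (s1 * t2 - s2 * t1) * f2 =
        t1 * (f1 * s1 + f2 * s2 + f3 * s3) - s1 * (f1 * t1 + f2 * t2 + f3 * t3)"
      by (simp add: algebra_simps)
    then show "(s3 * t1 - s1 * t3) * f3 = (s1 * t2 - s2 * t1) * f2" using that by simp
    have "(s1 * t2 - s2 * t1) * f1 - (s2 * t3 - s3 * t2) * f3 =
        t2 * (f1 * s1 + f2 * s2 + f3 * s3) - s2 * (f1 * t1 + f2 * t2 + f3 * t3)"
      by (simp add: algebra_simps)
    then show "(s1 * t2 - s2 * t1) * f1 = (s2 * t3 - s3 * t2) * f3" using that by simp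
  qed
  obtain a1 where a1: "r21 * u3 - r31 * u2 = a1 * f1" "r31 * u1 - r11 * u3 = a1 * f2"
      "r11 * u2 - r21 * u1 = a1 * f3"
    using cross[OF syz(1) u] by blast
  obtain a2 where a2: "r22 * u3 - r32 * u2 = a2 * f1" "r32 * u1 - r12 * u3 = a2 * f2"
      "r12 * u2 - r22 * u1 = a2 * f3"
    using cross[OF syz(2) u] by blast
  obtain a3 where a3: "r23 * u3 - r33 * u2 = a3 * f1" "r33 * u1 - r13 * u3 = a3 * f2"
      "r13 * u2 - r23 * u1 = a3 * f3"
    using cross[OF syz(3) u] by blast
  \<comment> \<open>The vanishing combination of the columns has zero cross product with
    \<open>u\<close>; this compares third coordinates.\<close>
  have "f3 * (x * a1 + y * a2 + z * a3) = x * (a1 * f3) + y * (a2 * f3) + z * (a3 * f3)"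
    by (simp add: algebra_simps)
  also have "\<dots> = (x * r11 + y * r12 + z * r13) * u2 - (x * r21 + y * r22 + z * r23) * u1"
    unfolding a1(3)[symmetric] a2(3)[symmetric] a3(3)[symmetric] by (simp add: algebra_simps)
  finally have "x * a1 + y * a2 + z * a3 = 0" using rel nz by simp
  then obtain \<alpha> \<beta> \<gamma> where k: "a1 = y * \<gamma> - z * \<beta>" "a2 = z * \<alpha> - x * \<gamma>" "a3 = x * \<beta> - y * \<alpha>"
    using koszul by blast
  obtain e where e: "r21 * r32 - r31 * r22 = e * f1" "r31 * r12 - r11 * r32 = e * f2"
      "r11 * r22 - r21 * r12 = e * f3"
    using cross[OF syz(1,2)] by blast
  \<comment> \<open>The given minor is the third coordinate of
    \<open>\<rho>\<^sub>1 \<times> \<rho>\<^sub>2\<close> and so fixes its multiplier.\<close>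
  have "e * f3 = (c * z) * f3"
    using trans[OF e(3)[symmetric]] minor by (metis mult.assoc mult.commute)
  then have e': "e = c * z" using nz by (metis mult_right_cancel)
  \<comment> \<open>Here \<open>p\<close> and \<open>q\<close> stand for two rows of
    \<open>r\<close>, and \<open>g\<close> for the complementary entry of the gradient. In these two
    coordinates \<open>u\<close>, corrected by a combination of the columns, becomes parallel to
    both \<open>\<rho>\<^sub>1\<close> and \<open>\<rho>\<^sub>2\<close>. The three cyclic choices
    of rows are used below.\<close>
  have step: "p1 * (uq + c' * (q1 * \<alpha> + q2 * \<beta> + q3 * \<gamma>)) =
      q1 * (up + c' * (p1 * \<alpha> + p2 * \<beta> + p3 * \<gamma>)) \<and>
      p2 * (uq + c' * (q1 * \<alpha> + q2 * \<beta> + q3 * \<gamma>)) = q2 * (up + c' * (p1 * \<alpha> + p2 * \<beta> + p3 * \<gamma>))"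
    if p: "x * p1 + y * p2 + z * p3 = 0" and q: "x * q1 + y * q2 + z * q3 = 0"
      and m: "p1 * q2 - q1 * p2 = e * g"
      and up: "p1 * uq - q1 * up = a1 * g" "p2 * uq - q2 * up = a2 * g"
    for p1 p2 p3 q1 q2 q3 up uq g
  proof -
    \<comment> \<open>The linear relation expresses \<open>z\<close> times the third column by the
      first two, so the minors with the third column follow from the first one after cancelling
      \<open>z\<close>.\<close>
    have "z * (p1 * q3 - q1 * p3 + c * y * g) =
        p1 * (x * q1 + y * q2 + z * q3) - q1 * (x * p1 + y * p2 + z * p3) -
            y * ((p1 * q2 - q1 * p2) - e * g)"
      unfolding e' by (simp add: algebra_simps)
    then have m13: "p1 * q3 - q1 * p3 = - c * y * g" using p q m nz
        by (simp add: eq_neg_iff_add_eq_0)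
    have "z * (p2 * q3 - q2 * p3 - c * x * g) =
        p2 * (x * q1 + y * q2 + z * q3) - q2 * (x * p1 + y * p2 + z * p3) +
            x * ((p1 * q2 - q1 * p2) - e * g)"
      unfolding e' by (simp add: algebra_simps)
    then have m23: "p2 * q3 - q2 * p3 = c * x * g" using p q m nz by simp
    have "p1 * (uq + c' * (q1 * \<alpha> + q2 * \<beta> + q3 * \<gamma>)) -
        q1 * (up + c' * (p1 * \<alpha> + p2 * \<beta> + p3 * \<gamma>)) =
        (p1 * uq - q1 * up) + c' * ((p1 * q2 - q1 * p2) * \<beta> + (p1 * q3 - q1 * p3) * \<gamma>)"
      by (simp add: algebra_simps)
    also have "\<dots> = (1 - c * c') * (a1 * g)"
      unfolding m13 m up e' k by (simp add: algebra_simps)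
    finally have 1: "p1 * (uq + c' * (q1 * \<alpha> + q2 * \<beta> + q3 * \<gamma>)) =
        q1 * (up + c' * (p1 * \<alpha> + p2 * \<beta> + p3 * \<gamma>))"
      using c by simp
    have "p2 * (uq + c' * (q1 * \<alpha> + q2 * \<beta> + q3 * \<gamma>)) -
        q2 * (up + c' * (p1 * \<alpha> + p2 * \<beta> + p3 * \<gamma>)) =
        (p2 * uq - q2 * up) + c' * ((p2 * q3 - q2 * p3) * \<gamma> - (p1 * q2 - q1 * p2) * \<alpha>)"
      by (simp add: algebra_simps)
    also have "\<dots> = (1 - c * c') * (a2 * g)"
      unfolding m23 m up e' k by (simp add: algebra_simps)
    finally show ?thesis using 1 c by simp
  qed
  define s1 where "s1 = u1 + c' * (r11 * \<alpha> + r12 * \<beta> + r13 * \<gamma>)"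
  define s2 where "s2 = u2 + c' * (r21 * \<alpha> + r22 * \<beta> + r23 * \<gamma>)"
  define s3 where "s3 = u3 + c' * (r31 * \<alpha> + r32 * \<beta> + r33 * \<gamma>)"
  have p: "r11 * s2 = r21 * s1" "r12 * s2 = r22 * s1"
    using step[OF rel(1,2) e(3) a1(3) a2(3)] by (simp_all add: s1_def s2_def)
  have q: "r21 * s3 = r31 * s2" "r22 * s3 = r32 * s2"
    using step[OF rel(2,3) e(1) a1(1) a2(1)] by (simp_all add: s2_def s3_def)
  have r: "r31 * s1 = r11 * s3" "r32 * s1 = r12 * s3"
    using step[OF rel(3,1) e(2) a1(2) a2(2)] by (simp_all add: s1_def s3_def)
  \<comment> \<open>The vector \<open>s\<close> is parallel to two independent columns, so the
    nonzero minor annihilates each of its coordinates.\<close>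
  have "(r11 * r22 - r12 * r21) * s1 = r11 * (r22 * s1) - r12 * (r21 * s1)"
    by (simp add: algebra_simps)
  also have "\<dots> = 0" unfolding p[symmetric] by (simp add: ac_simps)
  finally have "(r11 * r22 - r12 * r21) * s1 = 0" .
  moreover have "(r11 * r22 - r12 * r21) * s2 = r22 * (r11 * s2) - r21 * (r12 * s2)"
    by (simp add: algebra_simps)
  then have "(r11 * r22 - r12 * r21) * s2 = 0" unfolding p by (simp add: ac_simps)
  moreover have "(r11 * r22 - r12 * r21) * s3 = r11 * (r22 * s3) - r21 * (r12 * s3)"
    by (simp add: algebra_simps)
  then have "(r11 * r22 - r12 * r21) * s3 = r32 * (r11 * s2) - r32 * (r21 * s1)"
    unfolding q r[symmetric] by (simp add: ac_simps)
  then have "(r11 * r22 - r12 * r21) * s3 = 0" unfolding p by simp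
  moreover have "r11 * r22 - r12 * r21 \<noteq> 0"
    using minor nz c by auto
  ultimately have "s1 = 0" "s2 = 0" "s3 = 0" by auto
  then show ?thesis
    unfolding s1_def s2_def s3_def
    by (intro exI[of _ "- c' * \<alpha>"] exI[of _ "- c' * \<beta>"] exI[of _ "- c' * \<gamma>"])
      (simp add: algebra_simps eq_neg_iff_add_eq_0)
qed

text \<open>By Cramer's rule the kernel of two independent rows is a line over the fraction field,
  spanned by \<open>(x, y, z)\<close>. The hypothesis \<open>dvd\<close>, a coprimality of
  \<open>x\<close> and \<open>z\<close>, removes the denominator.\<close>

lemma second_syzygy_span:
  fixes x y z :: "'a::idom"
  assumes dvd: "\<And>b. z dvd x * b \<Longrightarrow> z dvd b"
    and rel: "x * r11 + y * r12 + z * r13 = 0" "x * r21 + y * r22 + z * r23 = 0"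
    and minor: "r11 * r22 - r12 * r21 \<noteq> 0"
    and nz: "z \<noteq> 0"
    and b: "r11 * b1 + r12 * b2 + r13 * b3 = 0" "r21 * b1 + r22 * b2 + r23 * b3 = 0"
  shows "\<exists>t. b1 = x * t \<and> b2 = y * t \<and> b3 = z * t"
proof -
  have "(r11 * r22 - r12 * r21) * (z * b1 - x * b3) = 0"
    "(r11 * r22 - r12 * r21) * (z * b2 - y * b3) = 0"
  proof -
    have "(r11 * r22 - r12 * r21) * (z * b1 - x * b3) =
        z * (r22 * (r11 * b1 + r12 * b2 + r13 * b3) - r12 * (r21 * b1 + r22 * b2 + r23 * b3)) -
        b3 * (r22 * (x * r11 + y * r12 + z * r13) - r12 * (x * r21 + y * r22 + z * r23))"
      by (simp add: algebra_simps)
    then show "(r11 * r22 - r12 * r21) * (z * b1 - x * b3) = 0" using rel b by simp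
    have "(r11 * r22 - r12 * r21) * (z * b2 - y * b3) =
        z * (r11 * (r21 * b1 + r22 * b2 + r23 * b3) - r21 * (r11 * b1 + r12 * b2 + r13 * b3)) -
        b3 * (r11 * (x * r21 + y * r22 + z * r23) - r21 * (x * r11 + y * r12 + z * r13))"
      by (simp add: algebra_simps)
    then show "(r11 * r22 - r12 * r21) * (z * b2 - y * b3) = 0" using rel b by simp
  qed
  then have *: "z * b1 = x * b3" "z * b2 = y * b3" using minor by auto
  then obtain t where "b3 = z * t" using dvd by (metis dvd_def)
  then show ?thesis using * nz by (intro exI[of _ t]) (auto simp: mult.left_commute)
qed

subsection \<open>Graded matrices\<close>

lemma less_3_iff: "i < 3 \<longleftrightarrow> i = 0 \<or> i = 1 \<or> i = (2::nat)"
  by auto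

lemma mult_mat_vec_3:
  assumes "A \<in> carrier_mat n 3" "v \<in> carrier_vec 3" "i < n"
  shows "(A *\<^sub>v v) $ i = A $$ (i, 0) * v $ 0 + A $$ (i, 1) * v $ 1 + A $$ (i, 2) * v $ 2"
  using assms by (simp add: scalar_prod_def numeral_3_eq_3 numeral_2_eq_2)

lemma mult_mat_vec_1:
  assumes "A \<in> carrier_mat n 1" "v \<in> carrier_vec 1" "i < n"
  shows "(A *\<^sub>v v) $ i = A $$ (i, 0) * v $ 0"
  using assms by (simp add: scalar_prod_def)

lemma homogeneous_sum: "(\<And>i. i \<in> I \<Longrightarrow> homogeneous n (p i)) \<Longrightarrow> homogeneous n (sum p I)"
  by (induction I rule: infinite_finite_induct) (auto intro: homogeneous_add)

text \<open>Entry \<open>(i, j)\<close> carries degree \<open>as ! j + k\<close> to degree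
  \<open>bs ! i + k\<close>, so its own degree is the difference of the shifts.\<close>

lemma graded_homI:
  assumes A: "A \<in> carrier_mat (length bs) (length as)"
    and hom: "\<And>i j. i < length bs \<Longrightarrow> j < length as \<Longrightarrow> homogeneous (bs ! i - as ! j) (A $$ (i, j))"
  shows "A \<in> graded_hom as bs"
proof -
  have "homogeneous (bs ! i + k) ((A *\<^sub>v v) $ i)" if v: "v \<in> graded_part as k"
      and i: "i < length bs" for k v i
  proof -
    have dim: "dim_vec v = length as" using v by (simp add: graded_part_def)
    have "homogeneous (bs ! i + k) (A $$ (i, j) * v $ j)" if "j < length as" for j
      using homogeneous_mult[OF hom[OF i that], of "as ! j + k" "v $ j"] v that
      by (simp add: graded_part_def)
    then show ?thesis
      using A i dim by (auto simp: scalar_prod_def intro!: homogeneous_sum)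
  qed
  then show ?thesis using A by (auto simp: graded_hom_def graded_part_def)
qed

text \<open>Splitting off the constant coefficient in \<open>Z\<close>, then \<open>Y\<close>, then
  \<open>X\<close> writes a polynomial without constant term as a combination of the three
  variables.\<close>

lemma irrelevant_ideal_eq: "irrelevant_ideal = {p. coeff3 p 0 0 0 = 0}"
proof (rule Set.set_eqI, rule iffI)
  fix p assume "p \<in> irrelevant_ideal"
  then obtain r s t where "p = X * r + Y * s + Z * t"
    by (auto simp: irrelevant_ideal_def Idl_triple)
  then show "p \<in> {p. coeff3 p 0 0 0 = 0}"
    by (simp add: coeff3_def coeff_mult X_def Y_def Z_def)
next
  fix p assume "p \<in> {p. coeff3 p 0 0 0 = 0}"
  then have p: "coeff (coeff (coeff p 0) 0) 0 = 0" by (simp add: coeff3_def)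
  obtain a t where 1: "p = pCons a t" by (cases p)
  obtain b s where 2: "a = pCons b s" by (cases a)
  obtain c r where 3: "b = pCons c r" by (cases b)
  have "p = X * [:[:r:]:] + Y * [:s:] + Z * t"
    using p by (simp add: 1 2 3 X_def Y_def Z_def)
  then show "p \<in> irrelevant_ideal"
    unfolding irrelevant_ideal_def Idl_triple by blast
qed

lemma minimal_mapI:
  assumes A: "A \<in> carrier_mat m n"
    and hom: "\<And>i j. i < m \<Longrightarrow> j < n \<Longrightarrow> homogeneous d (A $$ (i, j))" and "d > 0"
  shows "minimal_map A"
proof -
  have "coeff3 ((A *\<^sub>v v) $ i) 0 0 0 = 0" if v: "v \<in> carrier_vec n" and i: "i < m" for v i
  proof -
    have "coeff3 (A $$ (i, j)) 0 0 0 = 0" if "j < n" for j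
      using hom[OF i that] \<open>d > 0\<close> unfolding homogeneous_def by (metis add_0 of_nat_0 less_irrefl)
    then have "coeff3 (A $$ (i, j) * v $ j) 0 0 0 = 0" if "j < n" for j
      using that by (simp add: coeff3_mult)
    then show ?thesis using A v i
      by (simp add: scalar_prod_def coeff3_def coeff_sum)
  qed
  then show ?thesis using A by (auto simp: minimal_map_def mat_image_def irrelevant_ideal_eq)
qed

subsection \<open>Linear coordinates\<close>

text \<open>
  The conditions hold for \<open>(X, Y, Z)\<close> with their partial derivatives and are stable under permuting and
  rescaling the coordinates, which is all that is needed below; \<open>ev a b c\<close> is the evaluation at the point
  with coordinates \<open>(a, b, c)\<close>.
\<close>

locale coordinates =
  fixes U V W :: poly3 and DU DV DW :: "poly3 \<Rightarrow> poly3"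
    and ev :: "complex \<Rightarrow> complex \<Rightarrow> complex \<Rightarrow> poly3 \<Rightarrow> complex"
  assumes derivation_D: "derivation DU" "derivation DV" "derivation DW"
    and D_coords: "DU U = 1" "DU V = 0" "DU W = 0" "DV U = 0" "DV V = 1" "DV W = 0"
      "DW U = 0" "DW V = 0" "DW W = 1"
    and D_Const: "DU (Const k) = 0" "DV (Const k) = 0" "DW (Const k) = 0"
    and homogeneous_coords: "homogeneous 1 U" "homogeneous 1 V" "homogeneous 1 W"
    and homogeneous_D: "homogeneous n p \<Longrightarrow> homogeneous (n - 1) (DU p)"
      "homogeneous n p \<Longrightarrow> homogeneous (n - 1) (DV p)"
          "homogeneous n p \<Longrightarrow> homogeneous (n - 1) (DW p)"
    and jacobian_ideal_eq: "jacobian_ideal f = {DU f * r + DV f * s + DW f * t | r s t. True}"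
    and koszul: "U * p + V * q + W * r = 0 \<Longrightarrow>
      \<exists>\<alpha> \<beta> \<gamma>. p = V * \<gamma> - W * \<beta> \<and> q = W * \<alpha> - U * \<gamma> \<and> r = U * \<beta> - V * \<alpha>"
    and ev_hom: "comm_ring_hom (ev a b c)"
    and ev_coords: "ev a b c U = a" "ev a b c V = b" "ev a b c W = c"
    and ev_Const: "ev a b c (Const k) = k"

lemma coordinates_swap12:
  assumes "coordinates U V W DU DV DW ev"
  shows "coordinates V U W DV DU DW (\<lambda>s t. ev t s)"
proof -
  interpret coordinates U V W DU DV DW ev by fact
  show ?thesis
  proof (rule coordinates.intro)
    show "jacobian_ideal f = {DV f * r + DU f * s + DW f * t | r s t. True}" for f
    proof -
      have "DV f * r + DU f * s + DW f * t = DU f * s + DV f * r + DW f * t" for r s t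
        by (rule arg_cong[OF add.commute])
      then show ?thesis unfolding jacobian_ideal_eq by (simp only:) blast
    qed
    show "\<exists>\<alpha> \<beta> \<gamma>. a = U * \<gamma> - W * \<beta> \<and> b = W * \<alpha> - V * \<gamma> \<and> c = V * \<beta> - U * \<alpha>"
      if eq: "V * a + U * b + W * c = 0" for a b c
    proof -
      obtain \<alpha> \<beta> \<gamma> where "b = V * \<gamma> - W * \<beta>" "a = W * \<alpha> - U * \<gamma>" "c = U * \<beta> - V * \<alpha>"
        using koszul[of b a c] eq by (auto simp: algebra_simps)
      \<comment> \<open>Exchanging two coordinates reverses the sign of a cross product, hence the
        negated, permuted witnesses.\<close>
      then show ?thesis by (intro exI[of _ "- \<beta>"] exI[of _ "- \<alpha>"] exI[of _ "- \<gamma>"]) simp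
    qed
  qed (fact derivation_D D_coords D_Const homogeneous_coords ev_hom ev_coords ev_Const
      | erule homogeneous_D)+
qed

lemma coordinates_swap23:
  assumes "coordinates U V W DU DV DW ev"
  shows "coordinates U W V DU DW DV (\<lambda>s t r. ev s r t)"
proof -
  interpret coordinates U V W DU DV DW ev by fact
  show ?thesis
  proof (rule coordinates.intro)
    show "jacobian_ideal f = {DU f * r + DW f * s + DV f * t | r s t. True}" for f
    proof -
      have "DU f * r + DW f * s + DV f * t = DU f * r + DV f * t + DW f * s" for r s t
        by (rule add.commute[THEN trans]) (simp add: ac_simps)
      then show ?thesis unfolding jacobian_ideal_eq by (simp only:) blast
    qed
    show "\<exists>\<alpha> \<beta> \<gamma>. a = W * \<gamma> - V * \<beta> \<and> b = V * \<alpha> - U * \<gamma> \<and> c = U * \<beta> - W * \<alpha>"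
      if eq: "U * a + W * b + V * c = 0" for a b c
    proof -
      obtain \<alpha> \<beta> \<gamma> where "a = V * \<gamma> - W * \<beta>" "c = W * \<alpha> - U * \<gamma>" "b = U * \<beta> - V * \<alpha>"
        using koszul[of a c b] eq by (auto simp: algebra_simps)
      then show ?thesis by (intro exI[of _ "- \<alpha>"] exI[of _ "- \<gamma>"] exI[of _ "- \<beta>"]) simp
    qed
  qed (fact derivation_D D_coords D_Const homogeneous_coords ev_hom ev_coords ev_Const
      | erule homogeneous_D)+
qed

text \<open>By the chain rule the derivative along \<open>W\<close> picks up the factor
  \<open>1 / k\<close>; evaluating the old coordinate at \<open>r / k\<close> gives the new one the
  value \<open>r\<close>.\<close>

lemma coordinates_scale:
  assumes "coordinates U V W DU DV DW ev" "k \<noteq> 0"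
  shows "coordinates U V (Const k * W) DU DV (\<lambda>p. Const (1 / k) * DW p) (\<lambda>s t r. ev s t (r / k))"
proof -
  interpret coordinates U V W DU DV DW ev by fact
  interpret DU: derivation DU by (fact derivation_D)
  interpret DV: derivation DV by (fact derivation_D)
  interpret DW: derivation DW by (fact derivation_D)
  have k: "Const (1 / k) * Const k = 1" "Const k * Const (1 / k) = 1"
    using \<open>k \<noteq> 0\<close> by (simp_all flip: Const_simps(2,6))
  have k': "Const (1 / k) * (Const k * p) = p" "Const k * (Const (1 / k) * p) = p" for p
    using k by (simp_all add: mult.assoc[symmetric])
  interpret ev: comm_ring_hom "ev s t r" for s t r by (fact ev_hom)
  show ?thesis
  proof (rule coordinates.intro)
    show "derivation (\<lambda>p. Const (1 / k) * DW p)"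
      by standard (simp_all add: DW.add DW.mult algebra_simps)
    show "jacobian_ideal f = {DU f * r + DV f * s + Const (1 / k) * DW f * t | r s t. True}" for f
    proof -
      have *: "DW f * t = Const (1 / k) * DW f * (Const k * t)"
        "Const (1 / k) * DW f * t = DW f * (Const (1 / k) * t)" for t
        using k' by (simp_all add: ac_simps)
      show ?thesis unfolding jacobian_ideal_eq
      proof (rule equalityI; rule subsetI)
        fix p assume "p \<in> {DU f * r + DV f * s + DW f * t | r s t. True}"
        then obtain r s t where "p = DU f * r + DV f * s + DW f * t" by blast
        then have "p = DU f * r + DV f * s + Const (1 / k) * DW f * (Const k * t)"
          using *(1)[of t] by argo
        then show "p \<in> {DU f * r + DV f * s + Const (1 / k) * DW f * t | r s t. True}" by blast
      next
        fix p assume "p \<in> {DU f * r + DV f * s + Const (1 / k) * DW f * t | r s t. True}"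
        then obtain r s t where "p = DU f * r + DV f * s + Const (1 / k) * DW f * t" by blast
        then have "p = DU f * r + DV f * s + DW f * (Const (1 / k) * t)"
          using *(2)[of t] by argo
        then show "p \<in> {DU f * r + DV f * s + DW f * t | r s t. True}" by blast
      qed
    qed
    show "\<exists>\<alpha> \<beta> \<gamma>. a = V * \<gamma> - Const k * W * \<beta> \<and> b = Const k * W * \<alpha> - U * \<gamma> \<and> c = U * \<beta> - V * \<alpha>"
      if eq: "U * a + V * b + Const k * W * c = 0" for a b c
    proof -
      obtain \<alpha> \<beta> \<gamma> where ab: "a = V * \<gamma> - W * \<beta>" "b = W * \<alpha> - U * \<gamma>"
          and c: "Const k * c = U * \<beta> - V * \<alpha>"
        using koszul[of a b "Const k * c"] eq by (auto simp: algebra_simps)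
      have "c = Const (1 / k) * (U * \<beta> - V * \<alpha>)" using k'(1)[of c] c by simp
      then have "c = U * (Const (1 / k) * \<beta>) - V * (Const (1 / k) * \<alpha>)"
          by (simp add: algebra_simps)
      then show ?thesis using ab k'
        by (intro exI[of _ "Const (1 / k) * \<alpha>"] exI[of _ "Const (1 / k) * \<beta>"] exI[of _ \<gamma>])
          (simp add: ac_simps)
    qed
    show "homogeneous 1 (Const k * W)" by (intro homogeneous_Const_mult homogeneous_coords)
    show "homogeneous n p \<Longrightarrow> homogeneous (n - 1) (Const (1 / k) * DW p)" for n p
      by (intro homogeneous_Const_mult homogeneous_D)
  qed (fact derivation_D D_coords D_Const homogeneous_coords ev_hom ev_coords ev_Const
    | erule homogeneous_D
    | simp add: DU.mult DV.mult DW.mult D_coords D_Const ev.hom_mult ev_coords ev_Const k \<open>k \<noteq>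
        0\<close>)+
qed

text \<open>Setting \<open>Z\<close> and then \<open>Y\<close> to zero shows that \<open>a\<close>
  and \<open>b\<close> agree with a Koszul relation up to multiples of \<open>Z\<close>; cancelling
  \<open>Z\<close> in what remains determines \<open>c\<close>.\<close>

lemma koszul_XYZ:
  assumes "X * a + Y * b + Z * c = 0"
  shows "\<exists>\<alpha> \<beta> \<gamma>. a = Y * \<gamma> - Z * \<beta> \<and> b = Z * \<alpha> - X * \<gamma> \<and> c = X * \<beta> - Y * \<alpha>"
proof -
  obtain a0 a1 where a: "a = pCons a0 a1" by (cases a)
  obtain b0 b1 where b: "b = pCons b0 b1" by (cases b)
  obtain a00 a01 where a0: "a0 = pCons a00 a01" by (cases a0)
  have "[:[:0, 1:]:] * a0 + [:0, 1:] * b0 = 0"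
    using arg_cong[OF assms, of "\<lambda>p. coeff p 0"] by (simp add: a b X_def Y_def Z_def)
  then have "a00 = 0" "[:0, 1:] * ([:[:0, 1:]:] * a01 + b0) = 0"
    by (auto simp: a0)
  then have b0: "b0 = - ([:[:0, 1:]:] * a01)" by (simp add: eq_neg_iff_add_eq_0 add.commute)
  have a': "a = Y * [:a01:] + Z * a1" and b': "b = - (X * [:a01:]) + Z * b1"
    using \<open>a00 = 0\<close> by (simp_all add: a b a0 b0 X_def Y_def Z_def)
  have "Z * (X * a1 + Y * b1 + c) = 0"
    using assms unfolding a' b' by (simp add: algebra_simps)
  then have "X * a1 + Y * b1 + c = 0" by (simp add: Z_def)
  then have "c = - (X * a1) - Y * b1"
    using eq_neg_iff_add_eq_0[of c "X * a1 + Y * b1"] by (simp add: ac_simps)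
  then show ?thesis unfolding a' b'
    by (intro exI[of _ b1] exI[of _ "- a1"] exI[of _ "[:a01:]"]) simp
qed

definition eval3 :: "complex \<Rightarrow> complex \<Rightarrow> complex \<Rightarrow> poly3 \<Rightarrow> complex" where
  "eval3 s t r p = poly (poly (poly p [:[:r:]:]) [:t:]) s"

lemma coordinates_XYZ: "coordinates X Y Z dX dY dZ eval3"
proof (rule coordinates.intro)
  show "jacobian_ideal f = {dX f * r + dY f * s + dZ f * t | r s t. True}" for f
    by (simp add: jacobian_ideal_def Idl_triple)
  show "comm_ring_hom (eval3 s t r)" for s t r
    by standard (simp_all add: eval3_def)
qed (fact derivation_dX derivation_dY derivation_dZ homogeneous_X homogeneous_Y homogeneous_Z
    koszul_XYZ
  | erule homogeneous_dX homogeneous_dY homogeneous_dZ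
  | simp add: dX_def dY_def dZ_def X_def Y_def Z_def map_poly_pCons pderiv_pCons Const_def
      eval3_def one_pCons)+

subsection \<open>The resolution\<close>

lemma minimal_milnor_resolution_cong:
  "jacobian_ideal f = jacobian_ideal g \<Longrightarrow>
    minimal_milnor_resolution f F1 F2 F3 A1 A2 A3 = minimal_milnor_resolution g F1 F2 F3 A1 A2 A3"
  by (simp add: minimal_milnor_resolution_def milnor_proj_eq_zero)

context coordinates
begin

sublocale DU: derivation DU by (fact derivation_D)
sublocale DV: derivation DV by (fact derivation_D)
sublocale DW: derivation DW by (fact derivation_D)
sublocale ev: comm_ring_hom "ev a b c" for a b c by (fact ev_hom)

lemma ev_numeral: "ev a b c (numeral n) = numeral n"
  using ev_Const[of a b c "numeral n"] by (simp add: Const_simps)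

lemmas D_simps = DU.simps DV.simps DW.simps DU.power_numeral DV.power_numeral DW.power_numeral
    D_coords

lemmas ev_simps = ev.hom_add ev.hom_minus ev.hom_mult ev.hom_uminus ev.hom_power ev_coords
    ev_Const ev_numeral

lemma ev_eq_0: "p dvd q \<Longrightarrow> ev a b c p = 0 \<Longrightarrow> ev a b c q = 0"
  by (auto simp: ev.hom_mult elim: dvdE)

lemma coords_nonzero: "U \<noteq> 0" "V \<noteq> 0" "W \<noteq> 0"
  using D_coords DU.zero DV.zero DW.zero by fastforce+

lemma linear_form_coords: "linear_form U" "linear_form V" "linear_form W"
  using coords_nonzero homogeneous_coords by (simp_all add: linear_form_def)

text \<open>A squarefreeness criterion in a form that passes to products of coprime factors.\<close>

definition coprime_gradient :: "poly3 \<Rightarrow> bool" where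
  "coprime_gradient p \<longleftrightarrow> (\<forall>q. prime_elem q \<longrightarrow> q dvd p \<longrightarrow> q dvd DU p \<longrightarrow> q dvd DV p \<longrightarrow> \<not> q dvd DW p)"

text \<open>A prime factor of the product divides exactly one of the factors, say \<open>p\<close>.
  By the Leibniz rule it then divides each derivative of \<open>p\<close> times \<open>q\<close>,
  hence each derivative of \<open>p\<close>.\<close>

lemma coprime_gradient_mult:
  assumes "coprime_gradient p" "coprime_gradient q" "coprime p q"
  shows "coprime_gradient (p * q)"
  unfolding coprime_gradient_def
proof (intro allI impI notI)
  fix r assume r: "prime_elem r" "r dvd p * q" "r dvd DU (p * q)" "r dvd DV (p * q)"
      "r dvd DW (p * q)"
  have *: False if "coprime_gradient p" "r dvd p" "\<not> r dvd q" "r dvd DU (p * q)"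
      "r dvd DV (p * q)" "r dvd DW (p * q)" for p q
  proof -
    have "r dvd DU p * q" "r dvd DV p * q" "r dvd DW p * q"
      using that by (simp_all add: DU.mult DV.mult DW.mult dvd_add_left_iff)
    then have "r dvd DU p" "r dvd DV p" "r dvd DW p"
      using r(1) that(3) prime_elem_dvd_mult_iff by blast+
    then show False using that(1,2) r(1) by (auto simp: coprime_gradient_def)
  qed
  have "\<not> (r dvd p \<and> r dvd q)"
    using assms(3) r(1) by (meson coprime_def prime_elem_not_unit)
  then consider "r dvd p" "\<not> r dvd q" | "r dvd q" "\<not> r dvd p"
    using r(1,2) prime_elem_dvd_mult_iff by blast
  then show False
    by cases (use *[of p q] *[of q p] assms r in \<open>auto simp: mult.commute\<close>)
qed

text \<open>A repeated prime factor would divide every derivative.\<close>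

lemma squarefree_coprime_gradient:
  assumes "coprime_gradient p" "p \<noteq> 0"
  shows "squarefree p"
proof (rule squarefreeI)
  fix q assume q: "q\<^sup>2 dvd p"
  show "is_unit q"
  proof (rule ccontr)
    assume "\<not> is_unit q"
    moreover have "q \<noteq> 0" using q assms(2) by auto
    ultimately obtain r where r: "prime r" "r dvd q"
      using prime_divisor_exists by blast
    obtain s t where "q = r * s" "p = q\<^sup>2 * t" using q r by (auto elim!: dvdE)
    then have p: "p = r * (r * (s\<^sup>2 * t))" by (simp add: power2_eq_square ac_simps)
    have "r dvd p" "r dvd DU p" "r dvd DV p" "r dvd DW p"
      unfolding p DU.mult DV.mult DW.mult by simp_all
    then show False using assms(1) r by (auto simp: coprime_gradient_def)
  qed
qed

lemma nearly_free_of_syzygies: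
  fixes f :: poly3
  assumes hom: "homogeneous 10 f" and euler: "U * DU f + V * DV f + W * DW f = 10 * f"
    and ns: "coprime_gradient f" and "DW f \<noteq> 0"
    and hom_r: "homogeneous 5 r11" "homogeneous 5 r12" "homogeneous 5 r13" "homogeneous 5 r21"
      "homogeneous 5 r22" "homogeneous 5 r23" "homogeneous 5 r31" "homogeneous 5 r32"
          "homogeneous 5 r33"
    and rel: "U * r11 + V * r12 + W * r13 = 0" "U * r21 + V * r22 + W * r23 = 0"
      "U * r31 + V * r32 + W * r33 = 0"
    and syz: "DU f * r11 + DV f * r21 + DW f * r31 = 0" "DU f * r12 + DV f * r22 + DW f * r32 = 0"
      "DU f * r13 + DV f * r23 + DW f * r33 = 0"
    and minor: "r11 * r22 - r12 * r21 = Const c * (W * DW f)" and "c \<noteq> 0"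
  shows "nearly_free f"
proof -
  have "f \<noteq> 0" using \<open>DW f \<noteq> 0\<close> DW.zero by blast
  \<comment> \<open>By Euler's relation a common prime factor of the partial derivatives divides
    \<open>10 * f\<close>, hence \<open>f\<close>, as 10 is a unit.\<close>
  have prim: "is_unit d" if d: "d dvd DU f" "d dvd DV f" "d dvd DW f" for d
  proof (rule ccontr)
    assume "\<not> is_unit d"
    moreover have "d \<noteq> 0" using d \<open>DW f \<noteq> 0\<close> by auto
    ultimately obtain q where q: "prime q" "q dvd d" using prime_divisor_exists by blast
    then have "q dvd 10 * f" using d unfolding euler[symmetric]
        by (meson dvd_add dvd_mult dvd_trans)
    moreover have "is_unit (10 :: poly3)" using is_unit_Const[of 10] by (simp add: Const_simps)
    ultimately have "q dvd f" by (simp add: dvd_mult_unit_iff')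
    then show False using ns q d unfolding coprime_gradient_def
        by (meson dvd_trans prime_imp_prime_elem)
  qed
  define F where "F = [DU f, DV f, DW f]"
  define M where "M = [[r11, r12, r13], [r21, r22, r23], [r31, r32, r33]]"
  define A1 where "A1 = mat 1 3 (\<lambda>(i, j). F ! j)"
  define A2 where "A2 = mat 3 3 (\<lambda>(i, j). M ! i ! j)"
  define A3 where "A3 = mat 3 1 (\<lambda>(i, j). [U, V, W] ! i)"
  have A: "A1 \<in> carrier_mat 1 3" "A2 \<in> carrier_mat 3 3" "A3 \<in> carrier_mat 3 1"
    by (simp_all add: A1_def A2_def A3_def)
  have A1: "(A1 *\<^sub>v v) $ 0 = DU f * v $ 0 + DV f * v $ 1 + DW f * v $ 2" if "v \<in> carrier_vec 3"
      for v
    using mult_mat_vec_3[OF A(1) that, of 0] by (simp add: A1_def F_def)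
  have A2: "(A2 *\<^sub>v v) $ 0 = r11 * v $ 0 + r12 * v $ 1 + r13 * v $ 2"
    "(A2 *\<^sub>v v) $ 1 = r21 * v $ 0 + r22 * v $ 1 + r23 * v $ 2"
    "(A2 *\<^sub>v v) $ 2 = r31 * v $ 0 + r32 * v $ 1 + r33 * v $ 2" if "v \<in> carrier_vec 3" for v
    using mult_mat_vec_3[OF A(2) that, of 0] mult_mat_vec_3[OF A(2) that, of 1]
      mult_mat_vec_3[OF A(2) that, of 2] by (simp_all add: A2_def M_def)
  have A3: "(A3 *\<^sub>v v) $ 0 = U * v $ 0" "(A3 *\<^sub>v v) $ 1 = V * v $ 0" "(A3 *\<^sub>v v) $ 2 = W * v $ 0"
    if "v \<in> carrier_vec 1" for v
    using mult_mat_vec_1[OF A(3) that, of 0] mult_mat_vec_1[OF A(3) that, of 1]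
      mult_mat_vec_1[OF A(3) that, of 2] by (simp_all add: A3_def)
  have D_hom: "homogeneous 9 (DU f)" "homogeneous 9 (DV f)" "homogeneous 9 (DW f)"
    using homogeneous_D[OF hom] by simp_all
  \<comment> \<open>For \<open>d = 10\<close> and exponents 5 the shifts are
    \<open>1 - d = -9\<close>, \<open>1 - d - 5 = -14\<close> and \<open>-e1 = -15\<close>.\<close>
  have "A1 \<in> graded_hom [-9, -9, -9] [0]"
    by (rule graded_homI) (use D_hom in \<open>auto simp: A1_def F_def less_3_iff numeral_3_eq_3
        less_Suc_eq nth_Cons'\<close>)
  moreover have "A2 \<in> graded_hom [-14, -14, -14] [-9, -9, -9]"
    by (rule graded_homI) (use hom_r in \<open>auto simp: A2_def M_def less_3_iff numeral_3_eq_3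
        less_Suc_eq nth_Cons'\<close>)
  moreover have "A3 \<in> graded_hom [-15] [-14, -14, -14]"
    by (rule graded_homI) (use homogeneous_coords in \<open>auto simp: A3_def less_3_iff numeral_3_eq_3
        less_Suc_eq nth_Cons'\<close>)
  moreover have "minimal_map A1"
    by (rule minimal_mapI[OF A(1), of 9]) (use D_hom in \<open>auto simp: A1_def F_def less_3_iff\<close>)
  moreover have "minimal_map A2"
    by (rule minimal_mapI[OF A(2), of 5]) (use hom_r in \<open>auto simp: A2_def M_def less_3_iff\<close>)
  moreover have "minimal_map A3"
    by (rule minimal_mapI[OF A(3), of 1]) (use homogeneous_coords in \<open>auto simp: A3_def
        less_3_iff\<close>)
  moreover have "mat_image A1 = {v \<in> carrier_vec 1. milnor_proj f (v $ 0) = \<zero>\<^bsub>milnor_algebra f\<^esub>}"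
    unfolding milnor_proj_eq_zero jacobian_ideal_eq
  proof (intro equalityI subsetI)
    fix v assume "v \<in> mat_image A1"
    then obtain w where "w \<in> carrier_vec 3" "v = A1 *\<^sub>v w" using A by (auto simp: mat_image_def)
    then show "v \<in> {v \<in> carrier_vec 1. v $ 0 \<in> {DU f * r + DV f * s + DW f * t |r s t. True}}"
      using A1[of w] A by auto
  next
    fix v assume "v \<in> {v \<in> carrier_vec 1. v $ 0 \<in> {DU f * r + DV f * s + DW f * t |r s t. True}}"
    then obtain r s t where v: "v \<in> carrier_vec 1" "v $ 0 = DU f * r + DV f * s + DW f * t"
        by blast
    have "v = A1 *\<^sub>v vec 3 (\<lambda>i. [r, s, t] ! i)"
      by (rule eq_vecI) (use A v A1[of "vec 3 (\<lambda>i. [r, s, t] ! i)"] in auto)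
    then show "v \<in> mat_image A1" using A by (auto simp: mat_image_def)
  qed
  moreover have "mat_image A2 = mat_kernel A1"
  proof (intro equalityI subsetI)
    fix v assume "v \<in> mat_image A2"
    then obtain w where w: "w \<in> carrier_vec 3" "v = A2 *\<^sub>v w" using A by (auto simp: mat_image_def)
    have v: "v \<in> carrier_vec 3" using w A by simp
    have "(A1 *\<^sub>v v) $ 0 = (DU f * r11 + DV f * r21 + DW f * r31) * w $ 0 +
        (DU f * r12 + DV f * r22 + DW f * r32) * w $ 1 +
            (DU f * r13 + DV f * r23 + DW f * r33) * w $ 2"
      unfolding A1[OF v] unfolding w(2) A2[OF w(1)] by (simp add: algebra_simps)
    then have "A1 *\<^sub>v v = 0\<^sub>v 1" using A by (intro eq_vecI) (auto simp: syz)
    then show "v \<in> mat_kernel A1" using A v by (simp add: mat_kernel_def)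
  next
    fix v assume "v \<in> mat_kernel A1"
    then have v: "v \<in> carrier_vec 3" "A1 *\<^sub>v v = 0\<^sub>v 1" using A by (auto simp: mat_kernel_def)
    then have *: "DU f * v $ 0 + DV f * v $ 1 + DW f * v $ 2 = 0" using A1[of v] by simp
    have c: "Const c * Const (1 / c) = 1" using \<open>c \<noteq> 0\<close> by (simp flip: Const_simps(2,6))
    have prim': "\<exists>a. u1 = a * DU f \<and> u2 = a * DV f \<and> u3 = a * DW f"
      if "u2 * DW f = u3 * DV f" "u3 * DU f = u1 * DW f" for u1 u2 u3
      using primitive_cross_product[OF prim \<open>DW f \<noteq> 0\<close> that] by blast
    obtain b1 b2 b3 where b: "v $ 0 = r11 * b1 + r12 * b2 + r13 * b3"
      "v $ 1 = r21 * b1 + r22 * b2 + r23 * b3" "v $ 2 = r31 * b1 + r32 * b2 + r33 * b3"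
      using syzygy_span[OF prim' koszul rel syz minor c coords_nonzero(3) \<open>DW f \<noteq> 0\<close> *] by blast
    let ?w = "vec 3 (\<lambda>i. [b1, b2, b3] ! i)"
    have "v = A2 *\<^sub>v ?w"
      by (rule eq_vecI) (use A v b A2[of ?w] in \<open>auto simp: less_3_iff\<close>)
    then show "v \<in> mat_image A2" using A by (auto simp: mat_image_def)
  qed
  moreover have "mat_image A3 = mat_kernel A2"
  proof (intro equalityI subsetI)
    fix v assume "v \<in> mat_image A3"
    then obtain w where w: "w \<in> carrier_vec 1" "v = A3 *\<^sub>v w" using A by (auto simp: mat_image_def)
    have v: "v \<in> carrier_vec 3" using w A by simp
    have "(A2 *\<^sub>v v) $ 0 = (U * r11 + V * r12 + W * r13) * w $ 0"
      "(A2 *\<^sub>v v) $ 1 = (U * r21 + V * r22 + W * r23) * w $ 0"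
      "(A2 *\<^sub>v v) $ 2 = (U * r31 + V * r32 + W * r33) * w $ 0"
      unfolding A2[OF v] unfolding w(2) A3[OF w(1)] by (simp_all add: algebra_simps)
    then have "A2 *\<^sub>v v = 0\<^sub>v 3" using A by (intro eq_vecI) (auto simp: rel less_3_iff)
    then show "v \<in> mat_kernel A2" using A v by (simp add: mat_kernel_def)
  next
    fix v assume "v \<in> mat_kernel A2"
    then have v: "v \<in> carrier_vec 3" "A2 *\<^sub>v v = 0\<^sub>v 3" using A by (auto simp: mat_kernel_def)
    then have *: "r11 * v $ 0 + r12 * v $ 1 + r13 * v $ 2 = 0"
        "r21 * v $ 0 + r22 * v $ 1 + r23 * v $ 2 = 0"
      using A2[of v] by simp_all
    \<comment> \<open>\<open>W\<close> is prime and does not divide \<open>U\<close>, since it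
      vanishes at (1, 0, 0) and \<open>U\<close> does not.\<close>
    have W: "W dvd b" if "W dvd U * b" for b
      using that prime_elem_linear_form[OF linear_form_coords(3)] ev_eq_0[of W U 1 0 0]
      by (auto simp: prime_elem_dvd_mult_iff ev_coords)
    have "r11 * r22 - r12 * r21 \<noteq> 0"
      using minor \<open>DW f \<noteq> 0\<close> \<open>c \<noteq> 0\<close> coords_nonzero by (simp add: Const_def)
    then obtain t where t: "v $ 0 = U * t" "v $ 1 = V * t" "v $ 2 = W * t"
      using second_syzygy_span[OF W rel(1,2) _ coords_nonzero(3) *] by blast
    let ?w = "vec 1 (\<lambda>i. t)"
    have "v = A3 *\<^sub>v ?w"
      by (rule eq_vecI) (use A v t A3[of ?w] in \<open>auto simp: less_3_iff\<close>)
    then show "v \<in> mat_image A3" using A by (auto simp: mat_image_def)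
  qed
  moreover have "mat_kernel A3 = {0\<^sub>v 1}"
  proof (intro equalityI subsetI)
    fix v assume "v \<in> mat_kernel A3"
    then have v: "v \<in> carrier_vec 1" "A3 *\<^sub>v v = 0\<^sub>v 3" using A by (auto simp: mat_kernel_def)
    then have "U * v $ 0 = 0" using A3[of v] by simp
    then show "v \<in> {0\<^sub>v 1}" using v coords_nonzero by (auto intro!: eq_vecI)
  next
    fix v assume "v \<in> {0\<^sub>v 1 :: poly3 vec}"
    then show "v \<in> mat_kernel A3" using A by (auto simp: mat_kernel_def)
  qed
  ultimately have "minimal_milnor_resolution f [-9, -9, -9] [-14, -14, -14] [-15] A1 A2 A3"
    by (simp add: minimal_milnor_resolution_def)
  then have "syzygy_curve f 10 3 [5, 5, 5] [15]"
    using hom \<open>f \<noteq> 0\<close> squarefree_coprime_gradient[OF ns]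
    by (auto simp: syzygy_curve_def reduced_curve_def numeral_3_eq_3)
  then show ?thesis unfolding nearly_free_def
      by (intro exI[of _ 10] exI[of _ 5] exI[of _ 15]) simp
qed

end

subsection \<open>The three configurations of lines\<close>

text \<open>
  The quartic forms in the identities are the entries \<open>w\<^sub>i\<^sub>j\<close> of \<open>nearly_free_of_derivations\<close>; they were found by
  solving the linear system for the syzygies of degree 5. The Groebner basis method needs its
  qualified name because HOL-Algebra has another method called \<open>algebra\<close>.
\<close>

lemma nearly_free_opposite_lines_identities:
  fixes U V W :: "'a::idom"
  assumes "fU = (4 * U ^ 3 * (U ^ 4 + V ^ 4 - W ^ 4) + (U ^ 4 + V ^ 4) * (4 * U ^ 3)) * (U ^ 2 -
      W ^ 2) + (U ^ 4 + V ^ 4) * (U ^ 4 + V ^ 4 - W ^ 4) * (2 * U)"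
    and "fV = (4 * V ^ 3 * (U ^ 4 + V ^ 4 - W ^ 4) + (U ^ 4 + V ^ 4) * (4 * V ^ 3)) * (U ^ 2 -
        W ^ 2)"
    and "fW = (U ^ 4 + V ^ 4) * (- (4 * W ^ 3)) * (U ^ 2 - W ^ 2) +
        (U ^ 4 + V ^ 4) * (U ^ 4 + V ^ 4 - W ^ 4) * (- (2 * W))"
  shows "U * fU + V * fV + W * fW =
      10 * ((U ^ 4 + V ^ 4) * (U ^ 4 + V ^ 4 - W ^ 4) * (U ^ 2 - W ^ 2))"
    "W * (fU * (- 5 * V ^ 3 * W) +
        fV * (5 * U ^ 3 * W) +
        fW * (- U * V ^ 3)) =
      U * (fU * (- 4 * U * V ^ 3) +
        fV * (5 * U ^ 4 + V ^ 4) +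
        fW * 0)"
    "W * (fU * (U ^ 3 * W + 3 * U * W ^ 3) +
        fV * (U ^ 2 * V * W + 3 * V * W ^ 3) +
        fW * (5 * U ^ 4 + U ^ 2 * W ^ 2 + 4 * V ^ 4 - 2 * W ^ 4)) =
      V * (fU * (- 4 * U * V ^ 3) +
        fV * (5 * U ^ 4 + V ^ 4) +
        fW * 0)"
    "2 * ((W * (U ^ 3 * W + 3 * U * W ^ 3) - V * (- 4 * U * V ^ 3)) *
        (U * (5 * U ^ 4 + V ^ 4) - W * (5 * U ^ 3 * W)) -
        (U * (- 4 * U * V ^ 3) - W * (- 5 * V ^ 3 * W)) *
        (W * (U ^ 2 * V * W + 3 * V * W ^ 3) - V * (5 * U ^ 4 + V ^ 4))) =
      - 5 * (W * fW)"
  unfolding assms by Groebner_Basis.algebra+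

text \<open>The lines are \<open>U = (1 + \<i>) W\<close> and \<open>U = (1 - \<i>) W\<close>. As
  both slopes have fourth power -4, they belong to \<open>U ^ 4 + 4 * W ^ 4\<close>; this scaling of
  \<open>W\<close> keeps all coefficients integral.\<close>

lemma nearly_free_adjacent_lines_identities:
  fixes U V W :: "'a::idom"
  assumes "fU = (4 * U ^ 3 * (U ^ 4 + V ^ 4 + 4 * W ^ 4) +
      (U ^ 4 + V ^ 4) * (4 * U ^ 3)) * (U ^ 2 - 2 * U * W + 2 * W ^ 2) +
      (U ^ 4 + V ^ 4) * (U ^ 4 + V ^ 4 + 4 * W ^ 4) * (2 * U - 2 * W)"
    and "fV = (4 * V ^ 3 * (U ^ 4 + V ^ 4 + 4 * W ^ 4) + (U ^ 4 + V ^ 4) * (4 * V ^ 3)) * (U ^ 2 -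
        2 * U * W + 2 * W ^ 2)"
    and "fW = (U ^ 4 + V ^ 4) * (16 * W ^ 3) * (U ^ 2 - 2 * U * W + 2 * W ^ 2) +
        (U ^ 4 + V ^ 4) * (U ^ 4 + V ^ 4 + 4 * W ^ 4) * (4 * W - 2 * U)"
  shows "U * fU + V * fV + W * fW =
      10 * ((U ^ 4 + V ^ 4) * (U ^ 4 + V ^ 4 + 4 * W ^ 4) * (U ^ 2 - 2 * U * W + 2 * W ^ 2))"
    "W * (fU * (10 * V ^ 3 * W - 9 * U * V ^ 3) +
        fV * (10 * U ^ 4 - 10 * U ^ 3 * W + V ^ 4) +
        fW * (V ^ 3 * W - U * V ^ 3)) =
      U * (fU * (- 4 * U * V ^ 3) +
        fV * (5 * U ^ 4 + V ^ 4) +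
        fW * 0)"
    "W * (fU * (U ^ 4 - 2 * U ^ 2 * W ^ 2 - 12 * U * W ^ 3) +
        fV * (U ^ 3 * V - 2 * U * V * W ^ 2 - 12 * V * W ^ 3) +
        fW * (5 * U ^ 4 + U ^ 3 * W - 2 * U * W ^ 3 + 4 * V ^ 4 + 8 * W ^ 4)) =
      V * (fU * (- 4 * U * V ^ 3) +
        fV * (5 * U ^ 4 + V ^ 4) +
        fW * 0)"
    "2 * ((W * (U ^ 4 - 2 * U ^ 2 * W ^ 2 - 12 * U * W ^ 3) - V * (- 4 * U * V ^ 3)) *
        (U * (5 * U ^ 4 + V ^ 4) - W * (10 * U ^ 4 - 10 * U ^ 3 * W + V ^ 4)) -
        (U * (- 4 * U * V ^ 3) - W * (10 * V ^ 3 * W - 9 * U * V ^ 3)) *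
        (W * (U ^ 3 * V - 2 * U * V * W ^ 2 - 12 * V * W ^ 3) - V * (5 * U ^ 4 + V ^ 4))) =
      - 5 * (W * fW)"
  unfolding assms by Groebner_Basis.algebra+

text \<open>The curve is symmetric in \<open>U\<close> and \<open>V\<close>, and so is the table of
  quartics: exchanging them amounts to exchanging the indices 1 and 2 in rows and columns.\<close>

lemma nearly_free_lines_in_two_pencils_identities:
  fixes U V W :: "'a::idom"
  assumes "fU = (4 * U ^ 3 * (U ^ 4 + V ^ 4 - W ^ 4) +
      (U ^ 4 + V ^ 4) * (4 * U ^ 3)) * ((U - W) * (V - W)) +
      (U ^ 4 + V ^ 4) * (U ^ 4 + V ^ 4 - W ^ 4) * (V - W)"
    and "fV = (4 * V ^ 3 * (U ^ 4 + V ^ 4 - W ^ 4) +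
        (U ^ 4 + V ^ 4) * (4 * V ^ 3)) * ((U - W) * (V - W)) +
        (U ^ 4 + V ^ 4) * (U ^ 4 + V ^ 4 - W ^ 4) * (U - W)"
    and "fW = (U ^ 4 + V ^ 4) * (- (4 * W ^ 3)) * ((U - W) * (V - W)) +
        (U ^ 4 + V ^ 4) * (U ^ 4 + V ^ 4 - W ^ 4) * (- (V - W) - (U - W))"
  shows "U * fU + V * fV + W * fW =
      10 * ((U ^ 4 + V ^ 4) * (U ^ 4 + V ^ 4 - W ^ 4) * ((U - W) * (V - W)))"
    "W * (fU * (U ^ 4 - U ^ 2 * V ^ 2 - U ^ 2 * V * W - 5 * U ^ 2 * W ^ 2 + U * V ^ 2 * W +
        U * V * W ^ 2 + 6 * U * W ^ 3 + 10 * V ^ 4 - 10 * V ^ 3 * W) +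
        fV * (10 * U ^ 3 * W - 9 * U ^ 3 * V - U * V ^ 3 - U * V ^ 2 * W - 5 * U * V * W ^ 2 +
            V ^ 3 * W + V ^ 2 * W ^ 2 + 6 * V * W ^ 3) +
        fW * (8 * U ^ 4 + U ^ 3 * W - 2 * U * V ^ 3 - U * V ^ 2 * W - U * V * W ^ 2 +
            5 * U * W ^ 3 + 10 * V ^ 4 + V ^ 2 * W ^ 2 + V * W ^ 3 - 4 * W ^ 4)) =
      U * (fU * (2 * U ^ 4 - 8 * U * V ^ 3 + 10 * V ^ 4) +
        fV * (10 * U ^ 4 - 8 * U ^ 3 * V + 2 * V ^ 4) +
        fW * (10 * U ^ 4 + 10 * V ^ 4))"
    "W * (fU * (U ^ 3 * W - U ^ 3 * V - U ^ 2 * V * W + U ^ 2 * W ^ 2 - 9 * U * V ^ 3 -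
        5 * U * V * W ^ 2 + 6 * U * W ^ 3 + 10 * V ^ 3 * W) +
        fV * (10 * U ^ 4 - 10 * U ^ 3 * W - U ^ 2 * V ^ 2 + U ^ 2 * V * W - U * V ^ 2 * W +
            U * V * W ^ 2 + V ^ 4 - 5 * V ^ 2 * W ^ 2 + 6 * V * W ^ 3) +
        fW * (10 * U ^ 4 - 2 * U ^ 3 * V - U ^ 2 * V * W + U ^ 2 * W ^ 2 - U * V * W ^ 2 +
            U * W ^ 3 + 8 * V ^ 4 + V ^ 3 * W + 5 * V * W ^ 3 - 4 * W ^ 4)) =
      V * (fU * (2 * U ^ 4 - 8 * U * V ^ 3 + 10 * V ^ 4) +
        fV * (10 * U ^ 4 - 8 * U ^ 3 * V + 2 * V ^ 4) +
        fW * (10 * U ^ 4 + 10 * V ^ 4))"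
    "2 * ((W * (U ^ 3 * W - U ^ 3 * V - U ^ 2 * V * W + U ^ 2 * W ^ 2 - 9 * U * V ^ 3 -
        5 * U * V * W ^ 2 + 6 * U * W ^ 3 + 10 * V ^ 3 * W) -
        V * (2 * U ^ 4 - 8 * U * V ^ 3 + 10 * V ^ 4)) *
        (U * (10 * U ^ 4 - 8 * U ^ 3 * V + 2 * V ^ 4) -
            W * (10 * U ^ 3 * W - 9 * U ^ 3 * V - U * V ^ 3 - U * V ^ 2 * W - 5 * U * V * W ^ 2 +
            V ^ 3 * W + V ^ 2 * W ^ 2 + 6 * V * W ^ 3)) -
        (U * (2 * U ^ 4 - 8 * U * V ^ 3 + 10 * V ^ 4) -
            W * (U ^ 4 - U ^ 2 * V ^ 2 - U ^ 2 * V * W - 5 * U ^ 2 * W ^ 2 + U * V ^ 2 * W +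
            U * V * W ^ 2 + 6 * U * W ^ 3 + 10 * V ^ 4 - 10 * V ^ 3 * W)) *
        (W * (10 * U ^ 4 - 10 * U ^ 3 * W - U ^ 2 * V ^ 2 + U ^ 2 * V * W - U * V ^ 2 * W +
            U * V * W ^ 2 + V ^ 4 - 5 * V ^ 2 * W ^ 2 + 6 * V * W ^ 3) -
            V * (10 * U ^ 4 - 8 * U ^ 3 * V + 2 * V ^ 4))) =
      40 * (W * fW)"
  unfolding assms by Groebner_Basis.algebra+

context coordinates
begin

lemmas homogeneous_intros = homogeneous_add homogeneous_diff homogeneous_uminus
    homogeneous_numeral
  homogeneous_Const homogeneous_coords homogeneous_multI homogeneous_powerI

text \<open>
  The columns of \<open>w\<close> are derivations \<open>\<delta>\<^sub>1, \<delta>\<^sub>2, \<delta>\<^sub>3\<close> of degree 4 with \<open>\<delta>\<^sub>j f = g x\<^sub>j\<close> for a common \<open>g\<close>, so that the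
  \<open>x\<^sub>i \<delta>\<^sub>j - x\<^sub>j \<delta>\<^sub>i\<close> are syzygies of degree 5.
\<close>

lemma nearly_free_of_derivations:
  fixes f :: poly3
  assumes hom: "homogeneous 10 f" and euler: "U * DU f + V * DV f + W * DW f = 10 * f"
    and ns: "coprime_gradient f" and "DW f \<noteq> 0"
    and hom_w: "homogeneous 4 w11" "homogeneous 4 w12" "homogeneous 4 w13" "homogeneous 4 w21"
      "homogeneous 4 w22" "homogeneous 4 w23" "homogeneous 4 w31" "homogeneous 4 w32"
          "homogeneous 4 w33"
    and D1: "W * (DU f * w11 + DV f * w21 + DW f * w31) =
        U * (DU f * w13 + DV f * w23 + DW f * w33)"
    and D2: "W * (DU f * w12 + DV f * w22 + DW f * w32) =
        V * (DU f * w13 + DV f * w23 + DW f * w33)"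
    and minor: "2 * ((W * w12 - V * w13) * (U * w23 - W * w21) -
        (U * w13 - W * w11) * (W * w22 - V * w23)) =
      k * (W * DW f)" and k: "k = Const c" "c \<noteq> 0"
  shows "nearly_free f"
proof (rule nearly_free_of_syzygies[OF hom euler ns \<open>DW f \<noteq> 0\<close>])
  have hom5: "homogeneous 5 (p * q)" if "homogeneous 1 p" "homogeneous 4 q" for p q
    using homogeneous_mult[OF that] by simp
  show "homogeneous 5 (W * w12 - V * w13)" "homogeneous 5 (U * w13 - W * w11)"
      "homogeneous 5 (V * w11 - U * w12)"
    "homogeneous 5 (W * w22 - V * w23)" "homogeneous 5 (U * w23 - W * w21)"
        "homogeneous 5 (V * w21 - U * w22)"
    "homogeneous 5 (W * w32 - V * w33)" "homogeneous 5 (U * w33 - W * w31)"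
        "homogeneous 5 (V * w31 - U * w32)"
    by (intro homogeneous_diff hom5 hom_w homogeneous_coords)+
  \<comment> \<open>Each row of the syzygy matrix is the cross product of a row of \<open>w\<close>
    with \<open>(U, V, W)\<close>, hence orthogonal to the latter.\<close>
  show "U * (W * w12 - V * w13) + V * (U * w13 - W * w11) + W * (V * w11 - U * w12) = 0"
    "U * (W * w22 - V * w23) + V * (U * w23 - W * w21) + W * (V * w21 - U * w22) = 0"
    "U * (W * w32 - V * w33) + V * (U * w33 - W * w31) + W * (V * w31 - U * w32) = 0"
    by (simp_all add: algebra_simps)
  show "DU f * (W * w12 - V * w13) + DV f * (W * w22 - V * w23) + DW f * (W * w32 - V * w33) = 0"
    using D2 by (simp add: algebra_simps)
  show "DU f * (U * w13 - W * w11) + DV f * (U * w23 - W * w21) + DW f * (U * w33 - W * w31) = 0"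
    using D1 by (simp add: algebra_simps)
  \<comment> \<open>The third syzygy follows from \<open>D1\<close> and \<open>D2\<close> once
    multiplied by \<open>W\<close>.\<close>
  have "W * (DU f * (V * w11 - U * w12) + DV f * (V * w21 - U * w22) + DW f * (V * w31 - U * w32))
      =
      V * (W * (DU f * w11 + DV f * w21 + DW f * w31)) -
          U * (W * (DU f * w12 + DV f * w22 + DW f * w32))"
    by (simp add: algebra_simps)
  also have "\<dots> = 0" unfolding D1 D2 by (simp add: ac_simps)
  finally show "DU f * (V * w11 - U * w12) + DV f * (V * w21 - U * w22) +
      DW f * (V * w31 - U * w32) = 0"
    using coords_nonzero by simp
  \<comment> \<open>Undoes the factor 2 that keeps the minor identities integral.\<close>
  have half: "Const (1 / 2) * (2 * p) = p" for p
    using Const_simps(2)[of "1 / 2" 2] by (simp add: mult.assoc[symmetric] Const_simps)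
  show "(W * w12 - V * w13) * (U * w23 - W * w21) - (U * w13 - W * w11) * (W * w22 - V * w23) =
      Const (c / 2) * (W * DW f)"
    using arg_cong[OF minor, of "(*) (Const (1 / 2))"] unfolding half k
    by (simp add: mult.assoc[symmetric] flip: Const_simps)
  show "c / 2 \<noteq> 0" using k(2) by simp
qed

section \<open>Coprimality and gradients of the factors\<close>

lemma is_unit_numeral: "is_unit (numeral n :: poly3)"
  using is_unit_Const[of "numeral n"] by (simp add: Const_simps)

text \<open>A prime \<open>l\<close> vanishing at a point where \<open>p\<close> does not cannot
  divide \<open>p\<close>; explicit points thus certify coprimality.\<close>

lemma coprime_linear_form:
  assumes "linear_form l" "ev a b c l = 0" "ev a b c p \<noteq> 0"
  shows "coprime p l"
  using assms ev_eq_0 prime_elem_imp_coprime[OF prime_elem_linear_form] by (metis coprime_commute)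

lemma coprime_gradient_linear_form:
  assumes "is_unit (DU p) \<or> is_unit (DV p)"
  shows "coprime_gradient p"
  using assms prime_elem_not_unit dvd_unit_imp_unit by (auto simp: coprime_gradient_def)

text \<open>A prime dividing both derivatives divides the coprime forms \<open>U\<close> and
  \<open>V\<close>. This covers both quartics, whatever their term in \<open>W\<close>.\<close>

lemma coprime_gradient_fermat:
  assumes "DU p = 4 * U ^ 3" "DV p = 4 * V ^ 3"
  shows "coprime_gradient p"
  unfolding coprime_gradient_def
proof (intro allI impI notI)
  fix q assume q: "prime_elem q" "q dvd DU p" "q dvd DV p"
  then have "q dvd U ^ 3" "q dvd V ^ 3"
    using is_unit_numeral unfolding assms by (simp_all add: dvd_mult_unit_iff')
  then have "q dvd U" "q dvd V" using q(1) prime_elem_dvd_power by blast+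
  moreover have "coprime V U"
    by (rule coprime_linear_form[of _ 0 1 0]) (simp_all add: linear_form_coords ev_coords)
  ultimately show False using q(1) by (meson coprime_def prime_elem_not_unit)
qed

text \<open>A common divisor of the quartics divides their difference
  \<open>Const k * W ^ 4\<close>, whereas \<open>U ^ 4 + V ^ 4\<close> is coprime to
  \<open>W\<close>.\<close>

lemma coprime_gradient_two_quartics:
  assumes "k \<noteq> 0"
  shows "coprime_gradient ((U ^ 4 + V ^ 4) * (U ^ 4 + V ^ 4 + Const k * W ^ 4))"
proof (intro coprime_gradient_mult coprime_gradient_fermat)
  have "coprime (U ^ 4 + V ^ 4) W"
    by (rule coprime_linear_form[of _ 1 0 0]) (simp_all add: linear_form_coords ev_simps)
  then have "coprime (U ^ 4 + V ^ 4) (Const k * W ^ 4)"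
    using is_unit_Const[OF assms] by (simp add: coprime_mult_right_iff is_unit_right_imp_coprime)
  then show "coprime (U ^ 4 + V ^ 4) (U ^ 4 + V ^ 4 + Const k * W ^ 4)"
    by (rule coprimeI[OF coprime_common_divisor]) (simp_all add: dvd_add_right_iff)
qed (simp_all add: D_simps D_Const)

lemma coprime_two_quartics:
  assumes "linear_form l" "ev a b c l = 0" "a ^ 4 + b ^ 4 \<noteq> 0" "a ^ 4 + b ^ 4 + k * c ^ 4 \<noteq> 0"
  shows "coprime ((U ^ 4 + V ^ 4) * (U ^ 4 + V ^ 4 + Const k * W ^ 4)) l"
  by (rule coprime_linear_form[OF assms(1,2)]) (use assms in \<open>simp add: ev_simps\<close>)

lemma linear_form_diff: "linear_form (U - Const a * W)" "linear_form (V - Const a * W)"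
proof -
  have "ev 1 1 0 (U - Const a * W) \<noteq> 0" "ev 1 1 0 (V - Const a * W) \<noteq> 0"
    by (simp_all add: ev_simps)
  then have "U - Const a * W \<noteq> 0" "V - Const a * W \<noteq> 0" by (metis ev.hom_zero)+
  then show "linear_form (U - Const a * W)" "linear_form (V - Const a * W)"
    unfolding linear_form_def by (auto intro!: homogeneous_diff homogeneous_Const_mult
        homogeneous_coords)
qed

lemma DW_nonzero: "ev a b c (DW p) \<noteq> 0 \<Longrightarrow> DW p \<noteq> 0"
  by auto

section \<open>The three normal forms\<close>

lemma nearly_free_opposite_lines: "nearly_free
    ((U ^ 4 + V ^ 4) * (U ^ 4 + V ^ 4 - W ^ 4) * (U ^ 2 - W ^ 2))"
proof -
  define f where "f = (U ^ 4 + V ^ 4) * (U ^ 4 + V ^ 4 - W ^ 4) * (U ^ 2 - W ^ 2)"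
  have DU: "DU f = (4 * U ^ 3 * (U ^ 4 + V ^ 4 - W ^ 4) +
      (U ^ 4 + V ^ 4) * (4 * U ^ 3)) * (U ^ 2 - W ^ 2) +
      (U ^ 4 + V ^ 4) * (U ^ 4 + V ^ 4 - W ^ 4) * (2 * U)"
    unfolding f_def by (simp add: D_simps)
  have DV: "DV f = (4 * V ^ 3 * (U ^ 4 + V ^ 4 - W ^ 4) +
      (U ^ 4 + V ^ 4) * (4 * V ^ 3)) * (U ^ 2 - W ^ 2)"
    unfolding f_def by (simp add: D_simps)
  have DW: "DW f = (U ^ 4 + V ^ 4) * (- (4 * W ^ 3)) * (U ^ 2 - W ^ 2) +
      (U ^ 4 + V ^ 4) * (U ^ 4 + V ^ 4 - W ^ 4) * (- (2 * W))"
    unfolding f_def by (simp add: D_simps)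
  have lines: "(U - Const 1 * W) * (U - Const (- 1) * W) = (U ^ 2 - W ^ 2)"
    by (simp add: Const_simps algebra_simps power2_eq_square)
  \<comment> \<open>The points (1, 1, 1) and (1, 1, -1) lie on one line each and on no other
    component.\<close>
  have "coprime ((U ^ 4 + V ^ 4) * (U ^ 4 + V ^ 4 + Const (- 1) * W ^ 4)) (U - Const 1 * W)"
    by (rule coprime_two_quartics[of _ 1 1 1]) (simp_all add: linear_form_diff ev_simps)
  moreover have "coprime ((U ^ 4 + V ^ 4) * (U ^ 4 + V ^ 4 + Const (- 1) * W ^ 4) * (U -
      Const 1 * W)) (U - Const (- 1) * W)"
    by (rule coprime_linear_form[of _ 1 1 "- 1"]) (simp_all add: linear_form_diff ev_simps)
  ultimately have "coprime_gradient ((U ^ 4 + V ^ 4) * (U ^ 4 + V ^ 4 +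
      Const (- 1) * W ^ 4) * (U - Const 1 * W) * (U - Const (- 1) * W))"
    by (intro coprime_gradient_mult[OF coprime_gradient_mult] coprime_gradient_two_quartics
        coprime_gradient_linear_form)
      (simp_all add: D_simps D_Const)
  then have ns: "coprime_gradient f"
    unfolding f_def mult.assoc lines by (simp add: Const_simps)
  have hom: "homogeneous 10 f" unfolding f_def by (rule homogeneous_intros | simp)+
  have "DW f \<noteq> 0" by (rule DW_nonzero[of 1 0 2]) (simp add: DW ev_simps)
  note ids = nearly_free_opposite_lines_identities[OF DU DV DW, folded f_def]
  have "nearly_free f"
    by (rule nearly_free_of_derivations[OF hom ids(1) ns \<open>DW f \<noteq> 0\<close> _ _ _ _ _ _ _ _ _ ids(2-4),
          where c = "- 5"])
      (rule homogeneous_intros | simp add: Const_simps)+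
  then show ?thesis by (simp only: f_def)
qed

lemma nearly_free_adjacent_lines: "nearly_free
    ((U ^ 4 + V ^ 4) * (U ^ 4 + V ^ 4 + 4 * W ^ 4) * (U ^ 2 - 2 * U * W + 2 * W ^ 2))"
proof -
  define f where "f = (U ^ 4 + V ^ 4) * (U ^ 4 + V ^ 4 + 4 * W ^ 4) * (U ^ 2 - 2 * U * W +
      2 * W ^ 2)"
  have DU: "DU f = (4 * U ^ 3 * (U ^ 4 + V ^ 4 + 4 * W ^ 4) +
      (U ^ 4 + V ^ 4) * (4 * U ^ 3)) * (U ^ 2 - 2 * U * W + 2 * W ^ 2) +
      (U ^ 4 + V ^ 4) * (U ^ 4 + V ^ 4 + 4 * W ^ 4) * (2 * U - 2 * W)"
    unfolding f_def by (simp add: D_simps)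
  have DV: "DV f = (4 * V ^ 3 * (U ^ 4 + V ^ 4 + 4 * W ^ 4) +
      (U ^ 4 + V ^ 4) * (4 * V ^ 3)) * (U ^ 2 - 2 * U * W + 2 * W ^ 2)"
    unfolding f_def by (simp add: D_simps)
  have DW: "DW f = (U ^ 4 + V ^ 4) * (16 * W ^ 3) * (U ^ 2 - 2 * U * W + 2 * W ^ 2) +
      (U ^ 4 + V ^ 4) * (U ^ 4 + V ^ 4 + 4 * W ^ 4) * (4 * W - 2 * U)"
    unfolding f_def by (simp add: D_simps)
  have lines: "(U - Const (1 + \<i>) * W) * (U - Const (1 - \<i>) * W) =
      (U ^ 2 - 2 * U * W + 2 * W ^ 2)"
  proof -
    have "Const (1 + \<i>) + Const (1 - \<i>) = 2" "Const (1 + \<i>) * Const (1 - \<i>) = 2"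
      by (simp_all add: algebra_simps flip: Const_simps)
    moreover have "(U - a * W) * (U - b * W) = U ^ 2 - (a + b) * U * W + (a * b) * W ^ 2" for a b
      by (simp add: algebra_simps power2_eq_square)
    ultimately show ?thesis by simp
  qed
  have "coprime ((U ^ 4 + V ^ 4) * (U ^ 4 + V ^ 4 + Const (4) * W ^ 4)) (U - Const (1 + \<i>) * W)"
    by (rule coprime_two_quartics[of _ "1 + \<i>" 1 1])
        (simp_all add: linear_form_diff ev_simps complex_eq_iff power4_eq_xxxx)
  moreover have "coprime ((U ^ 4 + V ^ 4) * (U ^ 4 + V ^ 4 + Const (4) * W ^ 4) * (U -
      Const (1 + \<i>) * W)) (U - Const (1 - \<i>) * W)"
    by (rule coprime_linear_form[of _ "1 - \<i>" 1 1])
        (simp_all add: linear_form_diff ev_simps complex_eq_iff power4_eq_xxxx)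
  ultimately have "coprime_gradient ((U ^ 4 + V ^ 4) * (U ^ 4 + V ^ 4 + Const (4) * W ^ 4) * (U -
      Const (1 + \<i>) * W) * (U - Const (1 - \<i>) * W))"
    by (intro coprime_gradient_mult[OF coprime_gradient_mult] coprime_gradient_two_quartics
        coprime_gradient_linear_form)
      (simp_all add: D_simps D_Const)
  then have ns: "coprime_gradient f"
    unfolding f_def mult.assoc lines by (simp add: Const_simps)
  have hom: "homogeneous 10 f" unfolding f_def by (rule homogeneous_intros | simp)+
  have "DW f \<noteq> 0" by (rule DW_nonzero[of 1 0 1]) (simp add: DW ev_simps)
  note ids = nearly_free_adjacent_lines_identities[OF DU DV DW, folded f_def]
  have "nearly_free f"
    by (rule nearly_free_of_derivations[OF hom ids(1) ns \<open>DW f \<noteq> 0\<close> _ _ _ _ _ _ _ _ _ ids(2-4),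
          where c = "- 5"])
      (rule homogeneous_intros | simp add: Const_simps)+
  then show ?thesis by (simp only: f_def)
qed

lemma nearly_free_lines_in_two_pencils: "nearly_free
    ((U ^ 4 + V ^ 4) * (U ^ 4 + V ^ 4 - W ^ 4) * ((U - W) * (V - W)))"
proof -
  define f where "f = (U ^ 4 + V ^ 4) * (U ^ 4 + V ^ 4 - W ^ 4) * ((U - W) * (V - W))"
  have DU: "DU f = (4 * U ^ 3 * (U ^ 4 + V ^ 4 - W ^ 4) +
      (U ^ 4 + V ^ 4) * (4 * U ^ 3)) * ((U - W) * (V - W)) +
      (U ^ 4 + V ^ 4) * (U ^ 4 + V ^ 4 - W ^ 4) * (V - W)"
    unfolding f_def by (simp add: D_simps)
  have DV: "DV f = (4 * V ^ 3 * (U ^ 4 + V ^ 4 - W ^ 4) +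
      (U ^ 4 + V ^ 4) * (4 * V ^ 3)) * ((U - W) * (V - W)) +
      (U ^ 4 + V ^ 4) * (U ^ 4 + V ^ 4 - W ^ 4) * (U - W)"
    unfolding f_def by (simp add: D_simps)
  have DW: "DW f = (U ^ 4 + V ^ 4) * (- (4 * W ^ 3)) * ((U - W) * (V - W)) +
      (U ^ 4 + V ^ 4) * (U ^ 4 + V ^ 4 - W ^ 4) * (- (V - W) - (U - W))"
    unfolding f_def by (simp add: D_simps)
  have lines: "(U - Const 1 * W) * (V - Const 1 * W) = ((U - W) * (V - W))"
    by (simp add: Const_simps)
  have "coprime ((U ^ 4 + V ^ 4) * (U ^ 4 + V ^ 4 + Const (- 1) * W ^ 4)) (U - Const 1 * W)"
    by (rule coprime_two_quartics[of _ 1 1 1]) (simp_all add: linear_form_diff ev_simps)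
  \<comment> \<open>At (1, 1, 1) both lines vanish; (2, 1, 1) lies on the second line only.\<close>
  moreover have "coprime ((U ^ 4 + V ^ 4) * (U ^ 4 + V ^ 4 + Const (- 1) * W ^ 4) * (U -
      Const 1 * W)) (V - Const 1 * W)"
    by (rule coprime_linear_form[of _ 2 1 1]) (simp_all add: linear_form_diff ev_simps)
  ultimately have "coprime_gradient ((U ^ 4 + V ^ 4) * (U ^ 4 + V ^ 4 +
      Const (- 1) * W ^ 4) * (U - Const 1 * W) * (V - Const 1 * W))"
    by (intro coprime_gradient_mult[OF coprime_gradient_mult] coprime_gradient_two_quartics
        coprime_gradient_linear_form)
      (simp_all add: D_simps D_Const)
  then have ns: "coprime_gradient f"
    unfolding f_def mult.assoc lines by (simp add: Const_simps)
  have hom: "homogeneous 10 f" unfolding f_def by (rule homogeneous_intros | simp)+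
  have "DW f \<noteq> 0" by (rule DW_nonzero[of 1 0 2]) (simp add: DW ev_simps)
  note ids = nearly_free_lines_in_two_pencils_identities[OF DU DV DW, folded f_def]
  have "nearly_free f"
    by (rule nearly_free_of_derivations[OF hom ids(1) ns \<open>DW f \<noteq> 0\<close> _ _ _ _ _ _ _ _ _ ids(2-4),
          where c = "40"])
      (rule homogeneous_intros | simp add: Const_simps)+
  then show ?thesis by (simp only: f_def)
qed

end

subsection \<open>Linear factors\<close>

text \<open>A unit factor changes neither the Jacobian ideal nor squarefreeness, so the same
  resolution serves.\<close>

lemma nearly_free_Const_mult:
  assumes "nearly_free f" "c \<noteq> 0"
  shows "nearly_free (Const c * f)"
proof -
  interpret coordinates X Y Z dX dY dZ eval3 by (rule coordinates_XYZ)
  have unit: "is_unit (Const c)" using assms(2) by (rule is_unit_Const)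
  then obtain u where u: "Const c * u = 1" by (metis dvdE)
  have "jacobian_ideal (Const c * f) = jacobian_ideal f"
  proof (rule equalityI; rule subsetI)
    fix p assume "p \<in> jacobian_ideal (Const c * f)"
    then obtain r s t where "p = dX (Const c * f) * r + dY (Const c * f) * s +
        dZ (Const c * f) * t"
      unfolding jacobian_ideal_eq by blast
    then have "p = dX f * (Const c * r) + dY f * (Const c * s) + dZ f * (Const c * t)"
      by (simp add: DU.mult DV.mult DW.mult D_Const ac_simps)
    then show "p \<in> jacobian_ideal f" unfolding jacobian_ideal_eq by blast
  next
    fix p assume "p \<in> jacobian_ideal f"
    then obtain r s t where p: "p = dX f * r + dY f * s + dZ f * t"
      unfolding jacobian_ideal_eq by blast
    have "Const c * q * (u * r) = (Const c * u) * (q * r)" for q r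
      by (simp only: ac_simps)
    then have *: "Const c * q * (u * r) = q * r" for q r
      unfolding u by simp
    then have "p = dX (Const c * f) * (u * r) + dY (Const c * f) * (u * s) +
        dZ (Const c * f) * (u * t)"
      unfolding p by (simp only: DU.mult DV.mult DW.mult D_Const mult_zero_left add_0_left *)
    then show "p \<in> jacobian_ideal (Const c * f)" unfolding jacobian_ideal_eq by blast
  qed
  moreover have "Const c \<noteq> 0" using unit by auto
  then have "reduced_curve (Const c * f) d" if "reduced_curve f d" for d
    using that unit unfolding reduced_curve_def squarefree_def
    by (auto simp: homogeneous_Const_mult dvd_mult_unit_iff')
  moreover have "minimal_milnor_resolution (Const c * f) = minimal_milnor_resolution f"
    using calculation(1) by (intro ext minimal_milnor_resolution_cong)
  ultimately have "syzygy_curve f d m ds es \<Longrightarrow> syzygy_curve (Const c * f) d m ds es" for d m ds es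
    unfolding syzygy_curve_def by simp
  then show ?thesis
    using assms(1) unfolding nearly_free_def by blast
qed

context coordinates
begin

text \<open>With a primitive eighth root of unity \<open>\<zeta>\<close> the quartic splits into
  four lines of slopes \<open>\<zeta>\<close>, \<open>- \<zeta>\<close>,
  \<open>\<i> * \<zeta>\<close>, \<open>- (\<i> * \<zeta>)\<close>; the prime \<open>l\<close>
  divides one of them and so is proportional to it.\<close>

lemma linear_factor_fermat:
  assumes "linear_form l" "l dvd U ^ 4 + W ^ 4"
  obtains a c where "a ^ 4 = -1" "c \<noteq> 0" "l = Const c * (U - Const a * W)"
proof -
  define \<zeta> where "\<zeta> = cis (pi / 4)"
  have \<zeta>: "\<zeta> ^ 4 = -1" by (simp add: \<zeta>_def DeMoivre cis_pi)
  have \<zeta>2: "Const (\<zeta> ^ 2) * Const (\<zeta> ^ 2) = -1"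
    using \<zeta> by (simp flip: Const_simps Const_power power_add)
  have diff: "(U - Const b * W) * (U - Const (- b) * W) = U ^ 2 - Const (b ^ 2) * W ^ 2" for b
    by (simp add: Const_simps power2_eq_square algebra_simps)
  have diff_sq: "(x - c * y) * (x + c * y) = x * x - (c * c) * (y * y)" for x y c :: poly3
    by (simp add: algebra_simps)
  have "Const ((\<i> * \<zeta>) ^ 2) = - Const (\<zeta> ^ 2)" by (simp add: power_mult_distrib Const_simps)
  then have "(U - Const \<zeta> * W) * (U - Const (- \<zeta>) * W)
      * ((U - Const (\<i> * \<zeta>) * W) * (U - Const (- (\<i> * \<zeta>)) * W)) =
      (U ^ 2 - Const (\<zeta> ^ 2) * W ^ 2) * (U ^ 2 + Const (\<zeta> ^ 2) * W ^ 2)"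
    unfolding diff by simp
  also have "\<dots> = U ^ 2 * U ^ 2 - (Const (\<zeta> ^ 2) * Const (\<zeta> ^ 2)) * (W ^ 2 * W ^ 2)"
    by (rule diff_sq)
  also have "\<dots> = U ^ 4 + W ^ 4" unfolding \<zeta>2 by (simp flip: power_add)
  finally have "l dvd (U - Const \<zeta> * W) * (U -
      Const (- \<zeta>) * W) * ((U - Const (\<i> * \<zeta>) * W) * (U - Const (- (\<i> * \<zeta>)) * W))"
    using assms(2) by (simp only:)
  then have "l dvd U - Const \<zeta> * W \<or> l dvd U - Const (- \<zeta>) * W \<or>
      l dvd U - Const (\<i> * \<zeta>) * W \<or> l dvd U - Const (- (\<i> * \<zeta>)) * W"
    by (simp only: prime_elem_dvd_mult_iff[OF prime_elem_linear_form[OF assms(1)]] disj_assoc)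
  then obtain a where a: "a \<in> {\<zeta>, - \<zeta>, \<i> * \<zeta>, - (\<i> * \<zeta>)}" "l dvd U - Const a * W"
    by blast
  have "a ^ 4 = -1" using a(1) \<zeta> by (auto simp: power_mult_distrib)
  moreover obtain c where "c \<noteq> 0" "l = Const c * (U - Const a * W)"
    using linear_form_dvd_linear_form[OF assms(1) linear_form_diff(1) a(2)] .
  ultimately show thesis by (rule that)
qed

text \<open>A double line would divide the derivative along \<open>U\<close>, which at the point (a,
  0, 1) of the line equals \<open>4 * a ^ 3\<close>.\<close>

lemma not_dvd_twice:
  assumes "a ^ 4 = -1"
  shows "\<not> (U - Const a * W) ^ 2 dvd (U ^ 4 + W ^ 4) * (V ^ 4 + W ^ 4)"
proof
  let ?l = "U - Const a * W"
  assume "?l ^ 2 dvd (U ^ 4 + W ^ 4) * (V ^ 4 + W ^ 4)"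
  then obtain r where r: "(U ^ 4 + W ^ 4) * (V ^ 4 + W ^ 4) = ?l * (?l * r)"
    unfolding dvd_def power2_eq_square mult.assoc by blast
  have "?l dvd DU ((U ^ 4 + W ^ 4) * (V ^ 4 + W ^ 4))"
    unfolding r DU.mult by simp
  then have "?l dvd 4 * U ^ 3 * (V ^ 4 + W ^ 4)" by (simp add: D_simps)
  then have "ev a 0 1 (4 * U ^ 3 * (V ^ 4 + W ^ 4)) = 0"
    by (rule ev_eq_0) (simp add: ev_simps)
  then have "a = 0" by (simp add: ev_simps)
  then show False using assms by simp
qed

text \<open>From \<open>a ^ 4 = b ^ 4\<close> and \<open>a \<noteq> b\<close> either
  \<open>b = - a\<close> (opposite roots) or \<open>b ^ 2 = - (a ^ 2)\<close> (adjacent roots); in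
  each case rescaling \<open>W\<close> gives a normal form.\<close>

lemma nearly_free_same_pencil:
  assumes a: "a ^ 4 = -1" and b: "b ^ 4 = -1" and "a \<noteq> b"
  shows "nearly_free ((U ^ 4 + V ^ 4) * (U ^ 4 + V ^ 4 +
      W ^ 4) * ((U - Const a * W) * (U - Const b * W)))"
proof -
  have *: "(U - Const a * W) * (U - Const b * W) = U ^ 2 - Const (a + b) * U * W +
      Const (a * b) * W ^ 2"
    by (simp add: Const_simps algebra_simps power2_eq_square)
  have "(a - b) * ((a + b) * (a ^ 2 + b ^ 2)) = a ^ 4 - b ^ 4"
    by (simp add: algebra_simps power2_eq_square power4_eq_xxxx)
  then have "a + b = 0 \<or> a ^ 2 + b ^ 2 = 0" using assms by auto
  then show ?thesis
  proof
    assume "a + b = 0"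
    then have b: "b = - a" by (simp add: eq_neg_iff_add_eq_0 add.commute)
    have "a \<noteq> 0" using a by auto
    interpret C: coordinates U V "Const a * W" DU DV "\<lambda>p. Const (1 / a) * DW p"
        "\<lambda>s t r. ev s t (r / a)"
      by (rule coordinates_scale) (fact coordinates_axioms \<open>a \<noteq> 0\<close>)+
    have 4: "(Const a * W) ^ 4 = - (W ^ 4)"
      using a by (simp add: power_mult_distrib Const_simps flip: Const_power)
    have 2: "(U - Const a * W) * (U - Const (- a) * W) = U ^ 2 - (Const a * W) ^ 2"
      by (simp add: Const_simps algebra_simps power2_eq_square)
    show ?thesis
      using C.nearly_free_opposite_lines unfolding b 2 4 by simp
  next
    assume sq: "a ^ 2 + b ^ 2 = 0"
    \<comment> \<open>as \<open>(a + b)\<^sup>2 = 2 a b\<close>, the product of the two lines is rational in \<open>U\<close> and \<open>(a + b) / 2 W\<close>\<close>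
    define k where "k = (a + b) / 2"
    have "k ^ 2 = (a ^ 2 + b ^ 2 + 2 * a * b) / 4"
      by (simp add: k_def power_divide power2_sum)
    then have k2: "k ^ 2 = a * b / 2" unfolding sq by simp
    \<comment> \<open>Here \<open>(a * b) ^ 2 = - (a ^ 4) = 1\<close>, so
      \<open>4 * k ^ 4 = 1\<close> and the rescaled quartic term has coefficient 4.\<close>
    have "(a * b) ^ 2 = a ^ 2 * (a ^ 2 + b ^ 2) - a ^ 4"
        by (simp add: algebra_simps power2_eq_square power4_eq_xxxx)
    then have "(a * b) ^ 2 = 1" using a sq by simp
    moreover have "k ^ 4 = (k ^ 2) ^ 2" by simp
    ultimately have "k ^ 4 = 1 / 4" unfolding k2 by (simp add: power_divide)
    then have k4: "4 * k ^ 4 = 1" by (simp only:) simp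
    then have "k \<noteq> 0" by auto
    interpret C: coordinates U V "Const k * W" DU DV "\<lambda>p. Const (1 / k) * DW p"
        "\<lambda>s t r. ev s t (r / k)"
      by (rule coordinates_scale) (fact coordinates_axioms \<open>k \<noteq> 0\<close>)+
    have 4: "4 * (Const k * W) ^ 4 = Const (4 * k ^ 4) * W ^ 4"
      by (simp add: power_mult_distrib Const_simps Const_power)
    have 2: "2 * (Const k * W) ^ 2 = Const (2 * k ^ 2) * W ^ 2"
      by (simp add: power_mult_distrib Const_simps Const_power)
    have 1: "2 * U * (Const k * W) = Const (2 * k) * U * W"
      by (simp add: Const_simps ac_simps)
    show ?thesis
      using C.nearly_free_adjacent_lines unfolding * 1 2 4 k2 k4 by (simp add: Const_simps k_def)
  qed
qed

text \<open>Scaling \<open>W\<close> by \<open>a\<close> and \<open>V\<close> by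
  \<open>a / b\<close> turns the lines into \<open>U - W\<close> and \<open>V - W\<close> up to the
  constant \<open>b / a\<close>. As \<open>a / b\<close> has fourth power 1, the term
  \<open>V ^ 4\<close> is unchanged.\<close>

lemma nearly_free_two_pencils:
  assumes a: "a ^ 4 = -1" and b: "b ^ 4 = -1"
  shows "nearly_free ((U ^ 4 + V ^ 4) * (U ^ 4 + V ^ 4 +
      W ^ 4) * ((U - Const a * W) * (V - Const b * W)))"
proof -
  have nz: "a \<noteq> 0" "b \<noteq> 0" using a b by auto
  then have "a / b \<noteq> 0" by simp
  \<comment> \<open>Conjugating with \<open>coordinates_swap23\<close> applies the scaling to the
    second coordinate.\<close>
  note scaled = coordinates_swap23[OF coordinates_scale[OF coordinates_swap23[OF
      coordinates_scale[OF coordinates_axioms \<open>a \<noteq> 0\<close>]] \<open>a / b \<noteq> 0\<close>]]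
  have "Const (b / a) * Const (a / b) = 1" using nz by (simp flip: Const_simps)
  then have V: "Const (b / a) * (Const (a / b) * V) = V" by (simp add: mult.assoc[symmetric])
  have W: "Const (b / a) * (Const a * W) = Const b * W"
    using nz by (simp add: mult.assoc[symmetric] flip: Const_simps)
  have "V - Const b * W = Const (b / a) * (Const (a / b) * V - Const a * W)"
    unfolding right_diff_distrib V W ..
  moreover have "(Const (a / b) * V) ^ 4 = V ^ 4" "(Const a * W) ^ 4 = - (W ^ 4)"
    using a b by (simp_all add: power_mult_distrib power_divide Const_simps flip: Const_power)
  ultimately have eq: "(U ^ 4 + V ^ 4) * (U ^ 4 + V ^ 4 +
      W ^ 4) * ((U - Const a * W) * (V - Const b * W)) =
      Const (b / a) * ((U ^ 4 + (Const (a / b) * V) ^ 4) * (U ^ 4 + (Const (a / b) * V) ^ 4 -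
          (Const a * W) ^ 4) *
        ((U - Const a * W) * (Const (a / b) * V - Const a * W)))"
    by (simp add: ac_simps)
  show ?thesis unfolding eq
    by (intro nearly_free_Const_mult coordinates.nearly_free_lines_in_two_pencils[OF scaled])
        (use nz in simp)
qed

section \<open>Arbitrary pairs of linear factors\<close>

lemma nearly_free_same_pencil_factors:
  assumes "linear_form l" "linear_form m" "l dvd U ^ 4 + W ^ 4" "m dvd U ^ 4 + W ^ 4"
    and "l * m dvd (U ^ 4 + W ^ 4) * (V ^ 4 + W ^ 4)"
  shows "nearly_free ((U ^ 4 + V ^ 4) * (U ^ 4 + V ^ 4 + W ^ 4) * (l * m))"
proof -
  obtain a c where a: "a ^ 4 = -1" "c \<noteq> 0" "l = Const c * (U - Const a * W)"
    using linear_factor_fermat assms(1,3) by blast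
  obtain b d where b: "b ^ 4 = -1" "d \<noteq> 0" "m = Const d * (U - Const b * W)"
    using linear_factor_fermat assms(2,4) by blast
  have lm: "l * m = Const (c * d) * ((U - Const a * W) * (U - Const b * W))"
    unfolding a b by (simp add: Const_simps ac_simps)
  \<comment> \<open>Equal roots would make the two factors proportional, giving a double line in the
    product of quartics.\<close>
  have "a \<noteq> b"
  proof
    assume "a = b"
    then have "(U - Const a * W) ^ 2 dvd l * m" unfolding lm by (simp add: power2_eq_square)
    then show False using not_dvd_twice[OF a(1)] assms(5) dvd_trans by blast
  qed
  then show ?thesis
    using nearly_free_Const_mult[OF nearly_free_same_pencil[OF a(1) b(1)], of "c * d"] a(2) b(2)
    unfolding lm by (simp add: ac_simps)
qed

lemma nearly_free_two_pencils_factors: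
  assumes "linear_form l" "linear_form m" "l dvd U ^ 4 + W ^ 4" "m dvd V ^ 4 + W ^ 4"
  shows "nearly_free ((U ^ 4 + V ^ 4) * (U ^ 4 + V ^ 4 + W ^ 4) * (l * m))"
proof -
  obtain a c where a: "a ^ 4 = -1" "c \<noteq> 0" "l = Const c * (U - Const a * W)"
    using linear_factor_fermat assms(1,3) by blast
  obtain b d where b: "b ^ 4 = -1" "d \<noteq> 0" "m = Const d * (V - Const b * W)"
    using coordinates.linear_factor_fermat[OF coordinates_swap12[OF coordinates_axioms]
        assms(2,4)] by blast
  have "l * m = Const (c * d) * ((U - Const a * W) * (V - Const b * W))"
    unfolding a b by (simp add: Const_simps ac_simps)
  then show ?thesis
    using nearly_free_Const_mult[OF nearly_free_two_pencils[OF a(1) b(1)], of "c * d"] a(2) b(2)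
    by (simp add: ac_simps)
qed

text \<open>By primality each line lies in one of the two pencils. The mixed cases differ by
  exchanging \<open>l\<close> and \<open>m\<close>, the unmixed ones by exchanging \<open>U\<close>
  and \<open>V\<close>.\<close>

lemma nearly_free_linear_factors:
  assumes lin: "linear_form l" "linear_form m"
      and dvd: "l * m dvd (U ^ 4 + W ^ 4) * (V ^ 4 + W ^ 4)"
  shows "nearly_free ((U ^ 4 + V ^ 4) * (U ^ 4 + V ^ 4 + W ^ 4) * (l * m))"
proof -
  interpret swap: coordinates V U W DV DU DW "\<lambda>s t. ev t s"
    by (rule coordinates_swap12) (fact coordinates_axioms)
  have "l dvd (U ^ 4 + W ^ 4) * (V ^ 4 + W ^ 4)" "m dvd (U ^ 4 + W ^ 4) * (V ^ 4 + W ^ 4)"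
    using dvd by (meson dvd_mult_left dvd_mult_right)+
  then have "l dvd U ^ 4 + W ^ 4 \<or> l dvd V ^ 4 + W ^ 4"
      "m dvd U ^ 4 + W ^ 4 \<or> m dvd V ^ 4 + W ^ 4"
    using lin by (simp_all add: prime_elem_linear_form prime_elem_dvd_mult_iff)
  then consider "l dvd U ^ 4 + W ^ 4" "m dvd U ^ 4 + W ^ 4" | "l dvd U ^ 4 + W ^ 4"
      "m dvd V ^ 4 + W ^ 4"
    | "l dvd V ^ 4 + W ^ 4" "m dvd U ^ 4 + W ^ 4" | "l dvd V ^ 4 + W ^ 4" "m dvd V ^ 4 + W ^ 4"
    by blast
  then show ?thesis
  proof cases
    case 1
    then show ?thesis by (intro nearly_free_same_pencil_factors lin dvd)
  next
    case 2
    then show ?thesis by (intro nearly_free_two_pencils_factors lin)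
  next
    case 3
    then show ?thesis using nearly_free_two_pencils_factors[OF lin(2,1)]
        by (simp add: mult.commute)
  next
    case 4
    then show ?thesis using swap.nearly_free_same_pencil_factors[OF lin] dvd
      by (simp add: mult.commute add.commute)
  qed
qed

end

theorem proposition4p9:
  fixes k i j :: nat and l :: "nat \<Rightarrow> poly3"
  assumes "k \<in> {1, 2, 3}"
    and "\<forall>n \<in> {1..8}. linear_form (l n)"
    and "R k = (\<Prod>n = 1..8. l n)"
    and "i \<in> {1..8}" and "j \<in> {1..8}" and "i \<noteq> j"
  shows "nearly_free (Q k * l i * l j)"
proof -
  \<comment> \<open>Since the indices differ, both factors split off, so their product divides
    \<open>R k\<close>.\<close>
  have "(\<Prod>n = 1..8. l n) = l i * (\<Prod>n \<in> {1..8} - {i}. l n)"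
    by (rule prod.remove) (use assms in auto)
  also have "(\<Prod>n \<in> {1..8} - {i}. l n) = l j * (\<Prod>n \<in> {1..8} - {i} - {j}. l n)"
    by (rule prod.remove) (use assms in auto)
  finally have dvd: "l i * l j dvd R k" unfolding assms(3) by (simp add: mult.assoc[symmetric])
  have lin: "linear_form (l i)" "linear_form (l j)" using assms(2,4,5) by blast+
  \<comment> \<open>In each permutation the last coordinate is the variable absent from the binary
    quartic factor of \<open>Q k\<close>.\<close>
  note XYZ = coordinates_XYZ
  note YZX = coordinates_swap23[OF coordinates_swap12[OF coordinates_XYZ]]
  note XZY = coordinates_swap23[OF coordinates_XYZ]
  from assms(1) consider "k = 1" | "k = 2" | "k = 3" by blast
  then show ?thesis
  proof cases
    case 1
    then show ?thesis
      using coordinates.nearly_free_linear_factors[OF XYZ lin]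
          dvd by (simp add: R_def Q_def mult.assoc)
  next
    case 2
    have "(Y ^ 4 + X ^ 4) * (Z ^ 4 + X ^ 4) = R k"
        "(Y ^ 4 + Z ^ 4) * (Y ^ 4 + Z ^ 4 + X ^ 4) = Q k"
      using 2 by (simp_all add: R_def Q_def ac_simps)
    then show ?thesis
      using coordinates.nearly_free_linear_factors[OF YZX lin] dvd by (simp add: mult.assoc)
  next
    case 3
    have "(X ^ 4 + Y ^ 4) * (Z ^ 4 + Y ^ 4) = R k"
        "(X ^ 4 + Z ^ 4) * (X ^ 4 + Z ^ 4 + Y ^ 4) = Q k"
      using 3 by (simp_all add: R_def Q_def ac_simps)
    then show ?thesis
      using coordinates.nearly_free_linear_factors[OF XZY lin] dvd by (simp add: mult.assoc)
  qed
qed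

end
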